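(* Let $N\ge2$ be an integer, $\mu>0$, and consider the continuous-time $(\mu,(c_j),N)$-random walk on $\Omega_N$, with associated sequence $(d_j)$ and normalizing constant $D=D_{(\mu)}$. Assume that $d_j\le d_{j+1}$ for all $j$ and $$\sum_j\frac1{d_j^{\mu}}=\infty .$$ (a) If $\mu\in\{1,2,3\}$, put $f_t^{(1)}=G_t(0,0)$, $f_t^{(2)}=G_t^2(0,0)$, $f_t^{(3)}=(G_t^2G)(0,0)$. Then $$f_t^{(\mu)}\sim\frac{N-1}{N\,D_{(\mu)}^{\mu}}\sum_{j=0}^{\lfloor\mu\log t/\log N\rfloor}\frac1{d_j^{\mu}}\qquad\text{as }t\to\infty .$$ (b) For general $\mu>0$, $$g_t^{(\mu)}\sim\frac{N-1}{N\,D_{(\mu)}^{\mu}}\sum_{j=0}^{\lfloor\mu\log t/\log N\rfloor}\frac1{d_j^{\mu}}\qquad\text{as }t\to\infty .$$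
   Context: $\Omega_N=\{x=(x_1,x_2,\dots): x_i\in\mathbb Z_N,\ x_i\ne0 \text{ for only finitely many } i\}$ with $\mathbb Z_N$ the cyclic group of order $N$ and componentwise addition mod $N$; $|x|=\max\{i:x_i\ne0\}$ for $x\neq 0$ and $|0|=0$. Given a probability distribution $(r_j)_{j\ge1}$ on $\{1,2,\dots\}$ with all $r_j>0$, the $r_j$-random walk on $\Omega_N$ has i.i.d. steps $\eta$ with $\mathbb P[\eta=y]=\frac{r_{|y|}}{N^{|y|-1}(N-1)}$ for $y\neq0$ and $\mathbb P[\eta=0]=0$; its continuous-time version has unit-rate exponential holding times and transition probability $p_t(x,y)$. For a positive sequence $(c_j)_{j\ge0}$ with $\sum_j c_jN^{-j/\mu}<\infty$, the $(\mu,(c_j),N)$-random walk is the $r_j$-random walk with $r_j=D\,c_{j-1}N^{-(j-1)/\mu}$, $j\ge1$, $D=D_{(\mu)}$ being the normalizing constant, and $$d_j=\frac N{N-1}c_j+\sum_{i=j+1}^\infty\frac{c_i}{N^{(i-j)/\mu}},\qquad j\ge0 .$$ With $T_t$ the semigroup of the walk, $G_t=\int_0^tT_s\,ds$, $G=\int_0^\infty T_s\,ds$, products and powers are operator compositions, and $A(0,0)=A1_{\{0\}}(0)$ for an operator $A$; e.g. $G_t^2(0,0)=\int_0^t\int_0^tp_{s+r}(0,0)\,ds\,dr$ and $(G_t^2G)(0,0)=\int_0^t\int_0^t\int_0^\infty p_{s+r+u}(0,0)\,du\,ds\,dr$. Finally $g_t^{(\mu)}=\frac1{\Gamma(\mu)}\int_0^ts^{\mu-1}p_s(0,0)\,ds$.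 $a_t\sim b_t$ means $a_t/b_t\to1$. *)

theory Defs
  imports
    "HOL-Probability.Probability"
    "HOL-Algebra.Elementary_Groups"
    "HOL-Algebra.Product_Groups"
begin

section \<open>The hierarchical group\<close>

definition hgroup :: "nat \<Rightarrow> (nat \<Rightarrow> int) monoid" where
  "hgroup N = sum_group {1..} (\<lambda>_. integer_mod_group N)"

definition hnorm :: "(nat \<Rightarrow> int) \<Rightarrow> nat" where
  "hnorm x = (if \<forall>i\<ge>1. x i = 0 then 0 else Max {i. 1 \<le> i \<and> x i \<noteq> 0})"


section \<open>The random walk with rates \<open>r\<close>\<close>

text \<open>Only the values \<open>r j\<close> with \<open>j \<ge> 1\<close> matter.\<close>

definition step_mass :: "nat \<Rightarrow> (nat \<Rightarrow> real) \<Rightarrow> (nat \<Rightarrow> int) \<Rightarrow> real" where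
  "step_mass N r y =
     (if y \<in> carrier (hgroup N) \<and> y \<noteq> \<one>\<^bsub>hgroup N\<^esub>
      then r (hnorm y) / (real N ^ (hnorm y - 1) * (real N - 1)) else 0)"

definition step_pmf :: "nat \<Rightarrow> (nat \<Rightarrow> real) \<Rightarrow> (nat \<Rightarrow> int) pmf" where
  "step_pmf N r = embed_pmf (step_mass N r)"

text \<open>Sample space of the continuous-time walk: a sequence of i.i.d. unit-rate exponential
  holding times and, independently, a sequence of i.i.d. steps.\<close>

definition walk_space ::
  "nat \<Rightarrow> (nat \<Rightarrow> real) \<Rightarrow> ((nat \<Rightarrow> real) \<times> (nat \<Rightarrow> nat \<Rightarrow> int)) measure" where
  "walk_space N r =
     (\<Pi>\<^sub>M i\<in>UNIV. density lborel (exponential_density 1)) \<Otimes>\<^sub>M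
     (\<Pi>\<^sub>M i\<in>UNIV. measure_pmf (step_pmf N r))"

text \<open>The number of jumps up to time \<open>t\<close>: jump number \<open>n + 1\<close> occurs at time
  \<open>\<tau> 0 + \<dots> + \<tau> n\<close>. The set is almost surely finite.\<close>

definition jump_count :: "(nat \<Rightarrow> real) \<Rightarrow> real \<Rightarrow> nat" where
  "jump_count \<tau> t = card {n. (\<Sum>i\<le>n. \<tau> i) \<le> t}"

primrec skeleton :: "nat \<Rightarrow> (nat \<Rightarrow> int) \<Rightarrow> (nat \<Rightarrow> nat \<Rightarrow> int) \<Rightarrow> nat \<Rightarrow> (nat \<Rightarrow> int)" where
  "skeleton N x \<eta> 0 = x"
| "skeleton N x \<eta> (Suc n) = skeleton N x \<eta> n \<otimes>\<^bsub>hgroup N\<^esub> \<eta> n"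

definition trans_prob ::
  "nat \<Rightarrow> (nat \<Rightarrow> real) \<Rightarrow> real \<Rightarrow> (nat \<Rightarrow> int) \<Rightarrow> (nat \<Rightarrow> int) \<Rightarrow> real" where
  "trans_prob N r t x y =
     \<P>(\<omega> in walk_space N r. skeleton N x (snd \<omega>) (jump_count (fst \<omega>) t) = y)"


section \<open>Semigroup and Green operators\<close>

text \<open>All kernels are nonnegative, so the operators act on functions with values in
  \<^typ>\<open>ennreal\<close>; their compositions are then always defined.\<close>

type_synonym hoperator = "((nat \<Rightarrow> int) \<Rightarrow> ennreal) \<Rightarrow> ((nat \<Rightarrow> int) \<Rightarrow> ennreal)"

definition semigroup_op :: "nat \<Rightarrow> (nat \<Rightarrow> real) \<Rightarrow> real \<Rightarrow> hoperator" where
  "semigroup_op N r t f x =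
     (\<integral>\<^sup>+ y. ennreal (trans_prob N r t x y) * f y \<partial>count_space (carrier (hgroup N)))"

definition green_upto :: "nat \<Rightarrow> (nat \<Rightarrow> real) \<Rightarrow> real \<Rightarrow> hoperator" where
  "green_upto N r t f x = (\<integral>\<^sup>+ s\<in>{0..t}. semigroup_op N r s f x \<partial>lborel)"

definition green :: "nat \<Rightarrow> (nat \<Rightarrow> real) \<Rightarrow> hoperator" where
  "green N r f x = (\<integral>\<^sup>+ s\<in>{0..}. semigroup_op N r s f x \<partial>lborel)"

text \<open>The value \<open>A(0,0)\<close>; an infinite value would be mapped to \<open>0\<close>.\<close>

definition at_zero :: "nat \<Rightarrow> hoperator \<Rightarrow> real" where
  "at_zero N A = enn2real (A (indicator {\<one>\<^bsub>hgroup N\<^esub>}) \<one>\<^bsub>hgroup N\<^esub>)"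

definition frac_green :: "nat \<Rightarrow> (nat \<Rightarrow> real) \<Rightarrow> real \<Rightarrow> real \<Rightarrow> real" where
  "frac_green N r \<mu> t =
     1 / Gamma \<mu> *
     (LBINT s:{0..t}. s powr (\<mu> - 1) * trans_prob N r s \<one>\<^bsub>hgroup N\<^esub> \<one>\<^bsub>hgroup N\<^esub>)"


section \<open>The rates of the \<open>(\<mu>, c, N)\<close>-random walk\<close>

definition norm_const :: "real \<Rightarrow> (nat \<Rightarrow> real) \<Rightarrow> nat \<Rightarrow> real" where
  "norm_const \<mu> c N = 1 / (\<Sum>j. c j * real N powr (- real j / \<mu>))"

definition rate :: "real \<Rightarrow> (nat \<Rightarrow> real) \<Rightarrow> nat \<Rightarrow> nat \<Rightarrow> real" where
  "rate \<mu> c N j = norm_const \<mu> c N * c (j - 1) * real N powr (- real (j - 1) / \<mu>)"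

definition dseq :: "real \<Rightarrow> (nat \<Rightarrow> real) \<Rightarrow> nat \<Rightarrow> nat \<Rightarrow> real" where
  "dseq \<mu> c N j =
     real N / (real N - 1) * c j + (\<Sum>\<^sub>\<infinity>i\<in>{j+1..}. c i / real N powr (real (i - j) / \<mu>))"


section \<open>The step masses form a probability distribution\<close>

lemma carrier_hgroup:
  assumes "N \<ge> 2"
  shows "carrier (hgroup N) =
    {x \<in> {1..} \<rightarrow>\<^sub>E {0..<int N}. finite {i. 1 \<le> i \<and> x i \<noteq> 0}}"
  using assms by (simp add: hgroup_def carrier_sum_group carrier_integer_mod_group)

lemma one_hgroup: "\<one>\<^bsub>hgroup N\<^esub> = (\<lambda>i\<in>{1..}. 0)"
  by (simp add: hgroup_def)

lemma hnorm_le_iff: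
  assumes "N \<ge> 2" "x \<in> carrier (hgroup N)"
  shows "hnorm x \<le> k \<longleftrightarrow> (\<forall>i>k. x i = 0)"
proof -
  have fin: "finite {i. 1 \<le> i \<and> x i \<noteq> 0}"
    using assms by (simp add: carrier_hgroup)
  show ?thesis
  proof (cases "\<forall>i\<ge>1. x i = 0")
    case True
    then show ?thesis by (auto simp: hnorm_def)
  next
    case False
    then have "{i. 1 \<le> i \<and> x i \<noteq> 0} \<noteq> {}" by auto
    then have "Max {i. 1 \<le> i \<and> x i \<noteq> 0} \<le> k \<longleftrightarrow> (\<forall>i\<in>{i. 1 \<le> i \<and> x i \<noteq> 0}. i \<le> k)"
      using fin by (subst Max_le_iff) auto
    also have "\<dots> \<longleftrightarrow> (\<forall>i>k. x i = 0)"
      by (metis (mono_tags, lifting) One_nat_def Suc_leI gr0I mem_Collect_eq not_less not_less_zero)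
    finally have "Max {i. 1 \<le> i \<and> x i \<noteq> 0} \<le> k \<longleftrightarrow> (\<forall>i>k. x i = 0)" .
    then show ?thesis using False by (simp add: hnorm_def)
  qed
qed

lemma card_hball:
  assumes "N \<ge> 2"
  shows "card {x \<in> carrier (hgroup N). hnorm x \<le> k} = N ^ k"
    and "finite {x \<in> carrier (hgroup N). hnorm x \<le> k}"
proof -
  let ?B = "{x \<in> carrier (hgroup N). hnorm x \<le> k}"
  let ?P = "{1..k} \<rightarrow>\<^sub>E {0..<int N}"
  have B: "x \<in> ?B \<longleftrightarrow> x \<in> {1..} \<rightarrow>\<^sub>E {0..<int N} \<and> (\<forall>i>k. x i = 0)" for x
  proof -
    have "finite {i. 1 \<le> i \<and> x i \<noteq> 0}" if "\<forall>i>k. x i = 0"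
      by (rule finite_subset[of _ "{..k}"]) (use that in \<open>auto simp: not_le[symmetric]\<close>)
    then show ?thesis
      using hnorm_le_iff[OF assms, of x k] by (auto simp: carrier_hgroup[OF assms])
  qed
  have bij: "bij_betw (\<lambda>x. restrict x {1..k}) ?B ?P"
  proof (rule bij_betwI[where g = "\<lambda>z. \<lambda>i\<in>{1..}. if i \<le> k then z i else 0"])
    show "(\<lambda>x. restrict x {1..k}) \<in> ?B \<rightarrow> ?P"
      using B by (auto simp: PiE_iff simp del: mem_Collect_eq)
    show "(\<lambda>z. \<lambda>i\<in>{1..}. if i \<le> k then z i else 0) \<in> ?P \<rightarrow> ?B"
    proof
      fix z assume z: "z \<in> ?P"
      show "(\<lambda>i\<in>{1..}. if i \<le> k then z i else 0) \<in> ?B"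
        unfolding B using z assms by (auto simp: PiE_iff)
    qed
    show "(\<lambda>i\<in>{1..}. if i \<le> k then restrict x {1..k} i else 0) = x" if "x \<in> ?B" for x
      using that unfolding B by (auto simp: PiE_iff fun_eq_iff extensional_def restrict_def not_le)
    show "restrict (\<lambda>i\<in>{1..}. if i \<le> k then z i else 0) {1..k} = z" if "z \<in> ?P" for z
      using that by (auto simp: PiE_iff fun_eq_iff extensional_def restrict_def)
  qed
  have "card ?B = card ?P" using bij by (rule bij_betw_same_card)
  then show "card ?B = N ^ k" by (simp add: card_PiE)
  have "finite ?P" by (intro finite_PiE) auto
  then show "finite ?B" using bij bij_betw_finite by blast
qed

lemma card_hsphere:
  assumes "N \<ge> 2" "j \<ge> 1"
  shows "card {x \<in> carrier (hgroup N). hnorm x = j} = N ^ (j - 1) * (N - 1)"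
    and "finite {x \<in> carrier (hgroup N). hnorm x = j}"
proof -
  let ?B = "\<lambda>k. {x \<in> carrier (hgroup N). hnorm x \<le> k}"
  have eq: "{x \<in> carrier (hgroup N). hnorm x = j} = ?B j - ?B (j - 1)"
    using assms by auto
  have "card (?B j - ?B (j - 1)) = N ^ j - N ^ (j - 1)"
    using card_hball[OF assms(1)] by (subst card_Diff_subset) auto
  also have "\<dots> = N ^ (j - 1) * (N - 1)"
    using assms by (cases j) (auto simp: algebra_simps)
  finally show "card {x \<in> carrier (hgroup N). hnorm x = j} = N ^ (j - 1) * (N - 1)"
    by (simp add: eq)
  show "finite {x \<in> carrier (hgroup N). hnorm x = j}"
    unfolding eq using card_hball[OF assms(1)] by blast
qed

lemma hnorm_eq_0_iff:
  assumes "N \<ge> 2" "x \<in> carrier (hgroup N)"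
  shows "hnorm x = 0 \<longleftrightarrow> x = \<one>\<^bsub>hgroup N\<^esub>"
  using hnorm_le_iff[OF assms, of 0] assms
  by (auto simp: one_hgroup carrier_hgroup PiE_iff extensional_def fun_eq_iff restrict_def Suc_le_eq)

lemma step_mass_nonneg:
  assumes "N \<ge> 2" "\<And>j. j \<ge> 1 \<Longrightarrow> r j > 0"
  shows "step_mass N r y \<ge> 0"
proof (cases "y \<in> carrier (hgroup N) \<and> y \<noteq> \<one>\<^bsub>hgroup N\<^esub>")
  case True
  then have "hnorm y \<ge> 1" using hnorm_eq_0_iff[OF assms(1), of y] by simp
  then show ?thesis using assms(2)[of "hnorm y"] assms(1) by (simp add: step_mass_def)
qed (auto simp: step_mass_def)

lemma nn_integral_step_mass:
  assumes N: "N \<ge> 2" and r: "\<And>j. j \<ge> 1 \<Longrightarrow> r j > 0" and sums: "(\<lambda>j. r (Suc j)) sums 1"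
  shows "(\<integral>\<^sup>+ y. ennreal (step_mass N r y) \<partial>count_space UNIV) = 1"
proof -
  let ?A = "\<lambda>j. {x \<in> carrier (hgroup N). hnorm x = Suc j}"
  let ?q = "\<lambda>j. r (Suc j) / (real N ^ j * (real N - 1))"
  have eq: "ennreal (step_mass N r y) = (\<Sum>j. ennreal (?q j) * indicator (?A j) y)" for y
  proof (cases "y \<in> carrier (hgroup N) \<and> y \<noteq> \<one>\<^bsub>hgroup N\<^esub>")
    case True
    then obtain k where k: "hnorm y = Suc k"
      using hnorm_eq_0_iff[OF N, of y] by (cases "hnorm y") auto
    have "(\<Sum>j. ennreal (?q j) * indicator (?A j) y) =
          (\<Sum>j\<in>{k}. ennreal (?q j) * indicator (?A j) y)"
      using k by (intro suminf_finite) auto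
    then show ?thesis using k True by (simp add: step_mass_def)
  next
    case False
    then have "y \<notin> ?A j" for j
      using hnorm_eq_0_iff[OF N, of y] by auto
    then show ?thesis using False by (auto simp: step_mass_def)
  qed
  have "(\<integral>\<^sup>+ y. ennreal (step_mass N r y) \<partial>count_space UNIV) =
        (\<Sum>j. \<integral>\<^sup>+ y. ennreal (?q j) * indicator (?A j) y \<partial>count_space UNIV)"
    unfolding eq by (rule nn_integral_suminf) auto
  also have "\<dots> = (\<Sum>j. ennreal (r (Suc j)))"
  proof (rule suminf_cong)
    fix j
    have "card (?A j) = N ^ j * (N - 1)" "finite (?A j)"
      using card_hsphere[OF N, of "Suc j"] by auto
    then have "(\<integral>\<^sup>+ y. ennreal (?q j) * indicator (?A j) y \<partial>count_space UNIV) =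
               ennreal (?q j) * ennreal (real (N ^ j * (N - 1)))"
      by (simp add: nn_integral_cmult_indicator ennreal_of_nat_eq_real_of_nat)
    also have "\<dots> = ennreal (?q j * real (N ^ j * (N - 1)))"
      using N r[of "Suc j"] by (intro ennreal_mult[symmetric]) auto
    also have "?q j * real (N ^ j * (N - 1)) = r (Suc j)"
      using N by (simp add: of_nat_diff)
    finally show "(\<integral>\<^sup>+ y. ennreal (?q j) * indicator (?A j) y \<partial>count_space UNIV) =
      ennreal (r (Suc j))" .
  qed
  also have "\<dots> = ennreal (\<Sum>j. r (Suc j))"
    using sums r by (intro suminf_ennreal2) (auto simp: sums_iff intro: less_imp_le)
  also have "\<dots> = 1" using sums by (simp add: sums_iff)
  finally show ?thesis .
qed

lemma pmf_step_pmf: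
  assumes "N \<ge> 2" "\<And>j. j \<ge> 1 \<Longrightarrow> r j > 0" "(\<lambda>j. r (Suc j)) sums 1"
  shows "pmf (step_pmf N r) y = step_mass N r y"
  unfolding step_pmf_def
  using step_mass_nonneg[of N r] nn_integral_step_mass[of N r] assms by (intro pmf_embed_pmf) auto

lemma rate_pos_sums:
  assumes "N \<ge> 2" "\<And>j. c j > 0" "summable (\<lambda>j. c j * real N powr (- real j / \<mu>))"
  shows "rate \<mu> c N j > 0" "(\<lambda>j. rate \<mu> c N (Suc j)) sums 1"
proof -
  let ?S = "\<Sum>j. c j * real N powr (- real j / \<mu>)"
  have S: "?S > 0" using assms by (intro suminf_pos) auto
  then show "rate \<mu> c N j > 0" using assms by (simp add: rate_def norm_const_def)
  have "(\<lambda>j. 1 / ?S * (c j * real N powr (- real j / \<mu>))) sums (1 / ?S * ?S)"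
    using assms(3) by (intro sums_mult summable_sums)
  then show "(\<lambda>j. rate \<mu> c N (Suc j)) sums 1"
    using S by (simp add: rate_def norm_const_def mult.assoc)
qed

section \<open>The events defining the transition probabilities are measurable\<close>

text \<open>The type of the steps is uncountable, so the group operation need not be measurable with
  respect to the product of two discrete sigma-algebras; one argues coordinatewise.\<close>

lemma sets_jump_count: "{\<omega> \<in> space (walk_space N r). jump_count (fst \<omega>) t = k} \<in> sets (walk_space N r)"
  unfolding jump_count_def walk_space_def by measurable
lemma prob_space_walk_space: "prob_space (walk_space N r)"
proof -
  interpret A: product_prob_space "\<lambda>_::nat. density lborel (exponential_density 1)" UNIV
    by (intro product_prob_spaceI prob_space_exponential_density) auto
  interpret B: product_prob_space "\<lambda>_::nat. measure_pmf (step_pmf N r)" UNIV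
    by (intro product_prob_spaceI prob_space_measure_pmf)
  interpret pair_prob_space "\<Pi>\<^sub>M i\<in>(UNIV::nat set). density lborel (exponential_density 1)" "\<Pi>\<^sub>M i\<in>(UNIV::nat set). measure_pmf (step_pmf N r)" ..
  show ?thesis unfolding walk_space_def by (rule P.prob_space_axioms)
qed
lemma measurable_skeleton_coord: "(\<lambda>\<omega>. skeleton N x (snd \<omega>) k i) \<in> walk_space N r \<rightarrow>\<^sub>M count_space UNIV"
proof (induction k)
case 0 show ?case by simp
next case (Suc k)
  have "(\<lambda>\<omega>. snd \<omega> k) \<in> walk_space N r \<rightarrow>\<^sub>M measure_pmf (step_pmf N r)"
    unfolding walk_space_def by measurable
  moreover have "(\<lambda>y. y i) \<in> measure_pmf (step_pmf N r) \<rightarrow>\<^sub>M count_space UNIV" by simp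
  ultimately have [measurable]: "(\<lambda>\<omega>. snd \<omega> k i) \<in> walk_space N r \<rightarrow>\<^sub>M count_space UNIV"
    by (rule measurable_compose)
  note Suc[measurable]
  show ?case
    by (simp add: hgroup_def)
qed
lemma sets_walk_event:
  "{\<omega> \<in> space (walk_space N r). skeleton N x (snd \<omega>) (jump_count (fst \<omega>) t) = y} \<in> sets (walk_space N r)"
proof -
  have "{\<omega> \<in> space (walk_space N r). skeleton N x (snd \<omega>) (jump_count (fst \<omega>) t) = y} = 
     {\<omega> \<in> space (walk_space N r). \<exists>k. jump_count (fst \<omega>) t = k \<and> (\<forall>i. skeleton N x (snd \<omega>) k i = y i)}"
    by (auto simp: fun_eq_iff)
  also have "\<dots> \<in> sets (walk_space N r)"
    using measurable_skeleton_coord[of N x _ _ r, measurable] sets_jump_count[of N r t, unfolded pred_def[symmetric], measurable]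
    by measurable
  finally show ?thesis .
qed

end

theory Submission
  imports Defs "HOL-Real_Asymp.Real_Asymp"
begin

text \<open>The semigroup is diagonalised by the spherical functions \<open>\<phi>\<^sub>j\<close> of the hierarchical group, with
  \<open>T\<^sub>t \<phi>\<^sub>j = exp (- h\<^sub>j t) \<phi>\<^sub>j\<close> and \<open>h\<^sub>j = D d\<^sub>j N\<^bsup>-j/\<mu>\<^esup>\<close>, and the point mass at \<open>0\<close> is
  \<open>\<Sum>\<^sub>j (N - 1) N\<^bsup>-j-1\<^esup> \<phi>\<^sub>j\<close>. Hence all the quantities in question have the form
  \<open>(N - 1) / (N D\<^bsup>\<mu>\<^esup>) \<Sum>\<^sub>j d\<^sub>j\<^bsup>-\<mu>\<^esup> \<Psi>(h\<^sub>j t)\<close> with \<open>\<Psi>\<close> rising from \<open>0\<close> to \<open>1\<close>: \<open>\<Psi>(u)\<close> is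
  \<open>1 - exp (- u)\<close>, \<open>(1 - exp (- u))\<^sup>2\<close> (for \<open>\<mu> = 2\<close> and \<open>\<mu> = 3\<close>), or the distribution function of
  the Gamma distribution with shape \<open>\<mu>\<close>. As \<open>t N\<^bsup>-j/\<mu>\<^esup>\<close> decreases geometrically in \<open>j\<close> and passes
  through \<open>1\<close> at \<open>j = \<mu> log t / log N\<close>, the factor \<open>\<Psi>(h\<^sub>j t)\<close> acts as a cutoff there up to a
  bounded error, which is negligible because \<open>\<Sum>\<^sub>j d\<^sub>j\<^bsup>-\<mu>\<^esup>\<close> diverges.\<close>

section \<open>Spherical functions\<close>

text \<open>The spherical functions of the group: if \<open>Suc j\<close> is the first
  level on which a character is nontrivial, its average over a sphere of radius \<open>k\<close> is \<open>1\<close> for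
  \<open>k \<le> j\<close>, \<open>- 1 / (N - 1)\<close> for \<open>k = Suc j\<close> and \<open>0\<close> beyond.\<close>

definition sph :: "nat \<Rightarrow> nat \<Rightarrow> (nat \<Rightarrow> int) \<Rightarrow> real" where
  "sph N j x = (real N * of_bool (\<forall>i>j. x i = 0) - of_bool (\<forall>i>Suc j. x i = 0)) / (real N - 1)"

lemma abs_sph_le_1:
  assumes "N \<ge> 2"
  shows "\<bar>sph N j x\<bar> \<le> 1"
proof -
  have "(\<forall>i>j. x i = 0) \<Longrightarrow> (\<forall>i>Suc j. x i = 0)" by simp
  then show ?thesis using assms by (auto simp: sph_def of_bool_def)
qed

section \<open>Balls as subgroups and sums over their cosets\<close>

lemma group_hgroup: "group (hgroup N)"
  by (auto simp: hgroup_def intro!: sum_group group_integer_mod_group)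

lemma hgroup_mult_nth: "i \<ge> 1 \<Longrightarrow> (x \<otimes>\<^bsub>hgroup N\<^esub> y) i = (x i + y i) mod int N"
  by (simp add: hgroup_def integer_mod_group_def)

lemma hgroup_nth_bounds:
  "N \<ge> 2 \<Longrightarrow> x \<in> carrier (hgroup N) \<Longrightarrow> i \<ge> 1 \<Longrightarrow> 0 \<le> x i \<and> x i < int N"
  by (auto simp: carrier_hgroup PiE_iff)

text \<open>Adding an element of a ball leaves the coordinates above its radius alone, because
  coordinates are stored as representatives in \<open>[0, N)\<close>. The condition
  \<open>i > k\<close> excludes the index 0, which lies outside the product.\<close>

lemma mult_in_ball_iff:
  assumes N: "N \<ge> 2" and x: "x \<in> carrier (hgroup N)" and y: "y \<in> carrier (hgroup N)"
    and "\<forall>i>k. y i = 0"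
  shows "(\<forall>i>k. (x \<otimes>\<^bsub>hgroup N\<^esub> y) i = 0) \<longleftrightarrow> (\<forall>i>k. x i = 0)"
proof -
  have "(x \<otimes>\<^bsub>hgroup N\<^esub> y) i = x i" if "i > k" for i
    using that assms(4) hgroup_nth_bounds[OF N x, of i] by (simp add: hgroup_mult_nth)
  then show ?thesis by auto
qed

lemma mult_in_ball_iff':
  assumes N: "N \<ge> 2" and x: "x \<in> carrier (hgroup N)" and y: "y \<in> carrier (hgroup N)"
    and "\<forall>i>k. x i = 0"
  shows "(\<forall>i>k. (x \<otimes>\<^bsub>hgroup N\<^esub> y) i = 0) \<longleftrightarrow> (\<forall>i>k. y i = 0)"
proof -
  have "(x \<otimes>\<^bsub>hgroup N\<^esub> y) i = y i" if "i > k" for i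
    using that assms(4) hgroup_nth_bounds[OF N y, of i] by (simp add: hgroup_mult_nth)
  then show ?thesis by auto
qed

lemma ball_eq:
  assumes "N \<ge> 2"
  shows "{y \<in> carrier (hgroup N). hnorm y \<le> m} = {y \<in> carrier (hgroup N). \<forall>i>m. y i = 0}"
  using hnorm_le_iff[OF assms] by auto

text \<open>Balls are subgroups: translation by a point of the larger ball permutes that ball, which
  contains the smaller one; translation by any other point gives a coset disjoint from both.\<close>

lemma sum_ball_translate:
  assumes N: "N \<ge> 2" and x: "x \<in> carrier (hgroup N)" and "k \<le> m"
  shows "(\<Sum>y \<in> {y \<in> carrier (hgroup N). hnorm y \<le> m}. of_bool (\<forall>i>k. (x \<otimes>\<^bsub>hgroup N\<^esub> y) i = 0) :: real)
    = real N ^ k * of_bool (\<forall>i>m. x i = 0)"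
proof -
  interpret group "hgroup N" by (rule group_hgroup)
  let ?B = "\<lambda>m. {y \<in> carrier (hgroup N). hnorm y \<le> m}"
  let ?f = "\<lambda>y. x \<otimes>\<^bsub>hgroup N\<^esub> y"
  have fin: "finite (?B m)" "finite (?B k)" using card_hball[OF N] by auto
  show ?thesis
  proof (cases "\<forall>i>m. x i = 0")
    case True
    have "?f ` ?B m \<subseteq> ?B m"
      using mult_in_ball_iff'[OF N x _ True] x unfolding ball_eq[OF N] by auto
    moreover have inj: "inj_on ?f (?B m)" using x by (auto simp: inj_on_def)
    ultimately have im: "?f ` ?B m = ?B m" using endo_inj_surj[OF fin(1)] by blast
    have "(\<Sum>y \<in> ?B m. of_bool (\<forall>i>k. ?f y i = 0) :: real) = (\<Sum>z \<in> ?f ` ?B m. of_bool (\<forall>i>k. z i = 0))"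
      by (subst sum.reindex[OF inj]) simp
    also have "\<dots> = (\<Sum>z \<in> ?B m. of_bool (\<forall>i>k. z i = 0))" by (simp only: im)
    also have "\<dots> = (\<Sum>z \<in> ?B k. 1)"
      using fin \<open>k \<le> m\<close> hnorm_le_iff[OF N, of _ k] hnorm_le_iff[OF N, of _ m]
      by (intro sum.mono_neutral_cong_right) (auto simp: fin)
    also have "\<dots> = real N ^ k" using card_hball(1)[OF N, of k] by simp
    finally show ?thesis using True by simp
  next
    case False
    have "\<not> (\<forall>i>k. ?f y i = 0)" if "y \<in> ?B m" for y
    proof
      assume "\<forall>i>k. ?f y i = 0"
      then have "\<forall>i>m. ?f y i = 0" using \<open>k \<le> m\<close> by auto
      then show False using False that mult_in_ball_iff[OF N x, of y m] unfolding ball_eq[OF N] by auto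
    qed
    then have "(\<Sum>y \<in> ?B m. of_bool (\<forall>i>k. ?f y i = 0) :: real) = 0" by (intro sum.neutral) auto
    then show ?thesis using False by auto
  qed
qed

text \<open>\<open>sph N j\<close> is constant on cosets of the ball of radius \<open>j\<close>. On
  a coset of any larger ball its two indicators either both vanish or carry the weights
  \<open>N * N^j\<close> and \<open>N^(j+1)\<close>, which cancel.\<close>

lemma sum_ball_sph:
  assumes N: "N \<ge> 2" and x: "x \<in> carrier (hgroup N)"
  shows "(\<Sum>y \<in> {y \<in> carrier (hgroup N). hnorm y \<le> m}. sph N j (x \<otimes>\<^bsub>hgroup N\<^esub> y)) =
    (if m \<le> j then real N ^ m * sph N j x else 0)"
proof (cases "m \<le> j")
  case True
  have "sph N j (x \<otimes>\<^bsub>hgroup N\<^esub> y) = sph N j x"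
    if "y \<in> carrier (hgroup N)" "\<forall>i>m. y i = 0" for y
    unfolding sph_def using True that mult_in_ball_iff[OF N x, of y j] mult_in_ball_iff[OF N x, of y "Suc j"]
    by simp
  then have "(\<Sum>y \<in> {y \<in> carrier (hgroup N). hnorm y \<le> m}. sph N j (x \<otimes>\<^bsub>hgroup N\<^esub> y)) =
    (\<Sum>y \<in> {y \<in> carrier (hgroup N). hnorm y \<le> m}. sph N j x)"
    unfolding ball_eq[OF N] by (intro sum.cong) auto
  then show ?thesis using card_hball(1)[OF N, of m] True by simp
next
  case False
  then show ?thesis
    by (simp add: sph_def sum_divide_distrib[symmetric] sum_subtractf sum_distrib_left[symmetric]
      sum_ball_translate[OF N x])
qed

text \<open>A sphere is a difference of consecutive balls. At \<open>m = j\<close> the larger ball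
  contributes nothing, whence the negative sign.\<close>

lemma sum_sphere_sph:
  assumes N: "N \<ge> 2" and x: "x \<in> carrier (hgroup N)"
  shows "(\<Sum>y \<in> {y \<in> carrier (hgroup N). hnorm y = Suc m}. sph N j (x \<otimes>\<^bsub>hgroup N\<^esub> y)) =
    (if m < j then real N ^ m * (real N - 1) * sph N j x else if m = j then - (real N ^ m) * sph N j x else 0)"
proof -
  let ?B = "\<lambda>m. {y \<in> carrier (hgroup N). hnorm y \<le> m}"
  have eq: "{y \<in> carrier (hgroup N). hnorm y = Suc m} = ?B (Suc m) - ?B m" by auto
  have "(\<Sum>y \<in> {y \<in> carrier (hgroup N). hnorm y = Suc m}. sph N j (x \<otimes>\<^bsub>hgroup N\<^esub> y)) =
    (\<Sum>y \<in> ?B (Suc m). sph N j (x \<otimes>\<^bsub>hgroup N\<^esub> y)) - (\<Sum>y \<in> ?B m. sph N j (x \<otimes>\<^bsub>hgroup N\<^esub> y))"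
    unfolding eq using card_hball(2)[OF N] by (intro sum_diff) auto
  then show ?thesis unfolding sum_ball_sph[OF N x] by (auto simp: algebra_simps)
qed

section \<open>The step law and its eigenvalues\<close>

locale hwalk =
  fixes N :: nat and r :: "nat \<Rightarrow> real"
  assumes N: "N \<ge> 2" and r_pos: "\<And>j. j \<ge> 1 \<Longrightarrow> r j > 0" and r_sums: "(\<lambda>j. r (Suc j)) sums 1"
begin

interpretation G: group "hgroup N" by (rule group_hgroup)

abbreviation C :: "(nat \<Rightarrow> int) set" where "C \<equiv> carrier (hgroup N)"
abbreviation \<phi> :: "nat \<Rightarrow> (nat \<Rightarrow> int) \<Rightarrow> real" where "\<phi> \<equiv> sph N"

text \<open>\<open>decay\<close> is the eigenvalue of the negative generator: with \<open>r = rate \<mu> c N\<close> it equals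
  \<open>D d\<^sub>j N\<^bsup>-j/\<mu>\<^esup>\<close>.\<close>

definition eigval :: "nat \<Rightarrow> real" where
  "eigval j = (\<Sum>i<j. r (Suc i)) - r (Suc j) / (real N - 1)"

definition decay :: "nat \<Rightarrow> real" where "decay j = 1 - eigval j"

text \<open>Total mass 1 turns the head of the rates into their tail, the shape in which
  \<open>dseq\<close> is defined. In this form all terms are positive.\<close>

lemma decay_altdef: "decay j = real N / (real N - 1) * r (Suc j) + (\<Sum>i. r (Suc (i + Suc j)))"
proof -
  have "(\<Sum>i. r (Suc (i + Suc j))) = 1 - (\<Sum>i<Suc j. r (Suc i))"
    using sums_split_initial_segment[OF r_sums, of "Suc j"] by (simp add: sums_iff)
  moreover have "real N / (real N - 1) * r (Suc j) = r (Suc j) + r (Suc j) / (real N - 1)"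
    using N by (simp add: field_simps)
  ultimately show ?thesis by (simp add: decay_def eigval_def)
qed

lemma decay_pos: "decay j > 0"
proof -
  have "(\<Sum>i. r (Suc (i + Suc j))) \<ge> 0"
    using sums_split_initial_segment[OF r_sums, of "Suc j"] r_pos
    by (intro suminf_nonneg) (auto simp: sums_iff less_imp_le)
  moreover have "real N / (real N - 1) * r (Suc j) > 0" using N r_pos by simp
  ultimately show ?thesis by (simp add: decay_altdef)
qed

lemma set_step_pmf: "set_pmf (step_pmf N r) \<subseteq> C - {\<one>\<^bsub>hgroup N\<^esub>}"
  using pmf_step_pmf[OF N r_pos r_sums] by (auto simp: set_pmf_iff step_mass_def split: if_splits)

text \<open>Given its norm, a step is uniform on a sphere, so the expectation splits into sphere
  sums. Spheres of radius above \<open>Suc j\<close> contribute nothing and the series is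
  finite.\<close>

lemma step_eigenfunction:
  assumes x: "x \<in> C"
  shows "(\<integral>y. \<phi> j (x \<otimes>\<^bsub>hgroup N\<^esub> y) \<partial>step_pmf N r) = eigval j * \<phi> j x"
proof -
  let ?A = "\<lambda>m. {y \<in> C. hnorm y = Suc m}"
  let ?f = "\<lambda>y. \<phi> j (x \<otimes>\<^bsub>hgroup N\<^esub> y)"
  let ?M = "measure_pmf (step_pmf N r)"
  have h1: "hnorm \<one>\<^bsub>hgroup N\<^esub> = 0" using hnorm_eq_0_iff[OF N G.one_closed] by simp
  have U: "(\<Union>m. ?A m) = C - {\<one>\<^bsub>hgroup N\<^esub>}"
    using hnorm_eq_0_iff[OF N] by (auto simp: h1 gr0_conv_Suc[symmetric])
  have *: "(LINT y:?A m|?M. ?f y) =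
      (if m < j then r (Suc m) * \<phi> j x else if m = j then - (r (Suc m) / (real N - 1)) * \<phi> j x else 0)" for m
  proof -
    have fin: "finite (?A m)" using card_hsphere(2)[OF N, of "Suc m"] by simp
    have "(LINT y:?A m|?M. ?f y) = (\<Sum>y\<in>?A m. indicator (?A m) y *\<^sub>R ?f y * pmf (step_pmf N r) y)"
      unfolding set_lebesgue_integral_def by (rule integral_measure_pmf_real[OF fin]) (auto simp: indicator_def split: if_splits)
    also have "\<dots> = (\<Sum>y\<in>?A m. ?f y * (r (Suc m) / (real N ^ m * (real N - 1))))"
      by (intro sum.cong) (auto simp: h1 pmf_step_pmf[OF N r_pos r_sums] step_mass_def)
    also have "\<dots> = (\<Sum>y\<in>?A m. ?f y) * (r (Suc m) / (real N ^ m * (real N - 1)))"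
      by (simp only: sum_distrib_right)
    finally show ?thesis using N by (simp add: sum_sphere_sph[OF N x])
  qed
  \<comment> \<open>The spheres miss only the identity, which a step almost surely avoids.\<close>
  have "(\<integral>y. ?f y \<partial>?M) = (LINT y:(\<Union>m. ?A m)|?M. ?f y)"
    unfolding set_lebesgue_integral_def U
    using set_step_pmf by (intro integral_cong_AE) (auto simp: AE_measure_pmf_iff indicator_def)
  also have "\<dots> = (\<Sum>m. LINT y:?A m|?M. ?f y)"
  proof (rule lebesgue_integral_countable_add)
    show "set_integrable ?M (\<Union>m. ?A m) ?f"
      unfolding set_integrable_def
      using abs_sph_le_1[OF N] by (intro measure_pmf.integrable_const_bound[where B = 1]) (auto simp: indicator_def)
  qed auto
  also have "\<dots> = (\<Sum>m<Suc j. LINT y:?A m|?M. ?f y)"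
    by (rule suminf_finite) (auto simp: *)
  also have "\<dots> = (\<Sum>m<j. r (Suc m) * \<phi> j x) - r (Suc j) / (real N - 1) * \<phi> j x"
    by (simp add: *)
  finally show ?thesis by (simp add: eigval_def left_diff_distrib sum_distrib_right)
qed

end

section \<open>The Poisson law of the jump count\<close>

abbreviation holding_times :: "(nat \<Rightarrow> real) measure" where
  "holding_times \<equiv> \<Pi>\<^sub>M i\<in>UNIV. density lborel (exponential_density 1)"

lemma prob_space_holding_times: "prob_space holding_times"
  by (intro prob_space_PiM prob_space_exponential_density) simp

lemma erlang_holding_times:
  "distributed holding_times lborel (\<lambda>\<tau>. \<Sum>i\<le>n. \<tau> i) (erlang_density n 1)"
proof -
  interpret prob_space holding_times by (rule prob_space_holding_times)
  let ?E = "density lborel (\<lambda>x. ennreal (exponential_density 1 x))"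
  interpret P: product_prob_space "\<lambda>_::nat. ?E" UNIV
    by (intro product_prob_spaceI prob_space_exponential_density) auto
  have comp: "distr holding_times borel (\<lambda>\<tau>. \<tau> i) = ?E" for i
  proof -
    have "distr holding_times ?E (\<lambda>\<tau>. \<tau> i) = ?E"
      using P.PiM_component[of i] by simp
    then show ?thesis by (simp cong: distr_cong)
  qed
  \<comment> \<open>The joint map is the identity of the product space, so independence reduces to
    the product measure having the right marginals.\<close>
  have "indep_vars (\<lambda>_. borel) (\<lambda>i \<tau>. \<tau> i) (UNIV :: nat set)"
  proof (subst indep_vars_iff_distr_eq_PiM)
    show "distr holding_times (\<Pi>\<^sub>M i\<in>UNIV. borel) (\<lambda>\<tau>. \<lambda>i\<in>UNIV. \<tau> i) =
      (\<Pi>\<^sub>M i\<in>UNIV. distr holding_times borel (\<lambda>\<tau>. \<tau> i))"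
      unfolding comp by (simp add: restrict_UNIV cong: sets_PiM_cong) (intro distr_id2 sets_PiM_cong; simp)
  qed auto
  then have "indep_vars (\<lambda>_. borel) (\<lambda>i \<tau>. \<tau> i) {..n}"
    by (rule indep_vars_subset) auto
  moreover have "distributed holding_times lborel (\<lambda>\<tau>. \<tau> i) (exponential_density 1)" for i
    unfolding distributed_def using comp[of i] by (auto cong: distr_cong simp: comp)
  ultimately show ?thesis
    using exponential_distributed_sum[of "{..n}" 1 "\<lambda>i \<tau>. \<tau> i"] by simp
qed

lemma prob_partial_sum_le:
  assumes "t \<ge> 0"
  shows "\<P>(\<tau> in holding_times. (\<Sum>i\<le>n. \<tau> i) \<le> t) = 1 - (\<Sum>k\<le>n. t ^ k * exp (- t) / fact k)"
proof -
  interpret prob_space holding_times by (rule prob_space_holding_times)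
  show ?thesis
    using erlang_distributed_le[OF erlang_holding_times, of t] assms by (simp add: erlang_CDF_def)
qed

lemma AE_holding_times_nonneg: "AE \<tau> in holding_times. \<forall>i. \<tau> i \<ge> 0"
proof -
  have "AE x in density lborel (exponential_density 1). (x::real) \<ge> 0"
    by (subst AE_density) (auto simp: exponential_density_def)
  then have "AE \<tau> in holding_times. \<tau> i \<ge> 0" for i
    by (intro AE_PiM_component prob_space_exponential_density) auto
  then show ?thesis by (simp add: AE_all_countable)
qed

text \<open>Excludes explosion: \<open>jump_count\<close> is a cardinality and would be 0 on an
  infinite set. The exceptional event has probability below every Poisson tail, and these tend to
  0.\<close>

lemma AE_partial_sums_unbounded:
  assumes "t \<ge> 0"
  shows "AE \<tau> in holding_times. \<exists>n. (\<Sum>i\<le>n. \<tau> i) > t"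
proof -
  interpret prob_space holding_times by (rule prob_space_holding_times)
  let ?A = "{\<tau> \<in> space holding_times. \<forall>n. (\<Sum>i\<le>n. \<tau> i) \<le> t}"
  have "(\<lambda>n. 1 - (\<Sum>k\<le>n. t ^ k * exp (- t) / fact k)) \<longlonglongrightarrow> 1 - 1"
  proof (intro tendsto_diff tendsto_const)
    have "(\<lambda>k. (t ^ k /\<^sub>R fact k) * exp (- t)) sums (exp t * exp (- t))"
      by (intro sums_mult2 exp_converges)
    then have "(\<lambda>k. t ^ k * exp (- t) / fact k) sums 1"
      by (simp add: exp_minus field_simps)
    then show "(\<lambda>n. \<Sum>k\<le>n. t ^ k * exp (- t) / fact k) \<longlonglongrightarrow> 1"
      by (simp add: sums_def_le)
  qed
  moreover have "prob ?A \<le> 1 - (\<Sum>k\<le>n. t ^ k * exp (- t) / fact k)" for n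
  proof -
    have "prob ?A \<le> prob {\<tau> \<in> space holding_times. (\<Sum>i\<le>n. \<tau> i) \<le> t}"
      by (intro finite_measure_mono) auto
    then show ?thesis using prob_partial_sum_le[OF assms, of n] by simp
  qed
  ultimately have "prob ?A \<le> 1 - 1"
    by (intro LIMSEQ_le_const[of _ _ "prob ?A"]) auto
  then have "prob ?A = 0" by (simp add: measure_le_0_iff)
  then have "AE \<tau> in holding_times. \<not> (\<forall>n. (\<Sum>i\<le>n. \<tau> i) \<le> t)"
    by (subst (asm) prob_eq_0) (auto simp: )
  then show ?thesis by (simp add: not_le)
qed

text \<open>The tails of the jump count are Erlang distribution functions, and their consecutive
  differences are the Poisson weights.\<close>

lemma prob_jump_count:
  assumes t: "t \<ge> 0"
  shows "\<P>(\<tau> in holding_times. jump_count \<tau> t = k) = t ^ k * exp (- t) / fact k"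
proof -
  interpret prob_space holding_times by (rule prob_space_holding_times)
  have ge: "AE \<tau> in holding_times. \<forall>n. n < jump_count \<tau> t \<longleftrightarrow> (\<Sum>i\<le>n. \<tau> i) \<le> t"
    using AE_holding_times_nonneg AE_partial_sums_unbounded[OF t]
  proof eventually_elim
    case (elim \<tau>)
    define T where "T = (\<lambda>n. \<Sum>i\<le>n. \<tau> i)"
    have mono: "T m \<le> T n" if "m \<le> n" for m n
      unfolding T_def using elim(1) that by (intro sum_mono2) auto
    \<comment> \<open>Nonnegative holding times make the partial sums monotone, so the indices
      counted form an initial segment; as they start at 0, the inequality with \<open>m\<close> is
      strict.\<close>
    define m where "m = (LEAST n. T n > t)"
    have m: "T m > t" unfolding m_def by (rule LeastI_ex) (use elim(2) in \<open>auto simp: T_def\<close>)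
    have "T n \<le> t \<longleftrightarrow> n < m" for n
      using not_less_Least[of n "\<lambda>n. T n > t"] mono[of m n] m unfolding m_def[symmetric] by force
    then have "{n. T n \<le> t} = {..<m}" by auto
    then have "jump_count \<tau> t = m" by (simp add: jump_count_def T_def)
    then show ?case using \<open>\<And>n. T n \<le> t \<longleftrightarrow> n < m\<close> by (simp add: T_def)
  qed
  have meas[measurable]: "(\<lambda>\<tau>. jump_count \<tau> t) \<in> measurable holding_times (count_space UNIV)"
    unfolding jump_count_def by measurable
  define Q where "Q = (\<lambda>n. \<P>(\<tau> in holding_times. n < jump_count \<tau> t))"
  have Q: "Q n = 1 - (\<Sum>k\<le>n. t ^ k * exp (- t) / fact k)" for n
    unfolding Q_def prob_partial_sum_le[OF t, symmetric]
    using ge by (intro measure_eq_AE) auto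
  show ?thesis
  proof (cases k)
    case 0
    have eq: "{\<tau> \<in> space holding_times. jump_count \<tau> t = 0} =
        space holding_times - {\<tau> \<in> space holding_times. 0 < jump_count \<tau> t}" by auto
    have "\<P>(\<tau> in holding_times. jump_count \<tau> t = 0) = 1 - Q 0"
      unfolding Q_def eq by (rule prob_compl) measurable
    then show ?thesis using 0 Q[of 0] by simp
  next
    case (Suc n)
    have eq: "{\<tau> \<in> space holding_times. jump_count \<tau> t = Suc n} =
      {\<tau> \<in> space holding_times. n < jump_count \<tau> t} - {\<tau> \<in> space holding_times. Suc n < jump_count \<tau> t}"
      by auto
    have "\<P>(\<tau> in holding_times. jump_count \<tau> t = Suc n) = Q n - Q (Suc n)"
      unfolding Q_def eq by (rule finite_measure_Diff) (measurable, auto)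
    then show ?thesis using Suc Q[of n] Q[of "Suc n"] by simp
  qed
qed

text \<open>This is the probability generating function of the Poisson law with mean
  \<open>t\<close>, obtained by integrating termwise over the values of the jump count.\<close>

lemma integral_power_jump_count:
  assumes t: "t \<ge> 0"
  shows "(\<integral>\<tau>. a ^ jump_count \<tau> t \<partial>holding_times) = exp ((a - 1) * t)"
proof -
  interpret prob_space holding_times by (rule prob_space_holding_times)
  have meas[measurable]: "(\<lambda>\<tau>. jump_count \<tau> t) \<in> measurable holding_times (count_space UNIV)"
    unfolding jump_count_def by measurable
  let ?A = "\<lambda>k. {\<tau> \<in> space holding_times. jump_count \<tau> t = k}"
  let ?f = "\<lambda>k \<tau>. a ^ k * indicator (?A k) \<tau>"
  \<comment> \<open>Stated for every base because absolute summability uses it at the absolute value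
    of \<open>a\<close>; the eigenvalue later put for \<open>a\<close> can be negative.\<close>
  have s: "(\<lambda>k. b ^ k * prob (?A k)) sums exp ((b - 1) * t)" for b :: real
  proof -
    have "(\<lambda>k. ((b * t) ^ k /\<^sub>R fact k) * exp (- t)) sums (exp (b * t) * exp (- t))"
      by (intro sums_mult2 exp_converges)
    then show ?thesis
      unfolding prob_jump_count[OF t]
      by (simp add: exp_minus exp_diff field_simps power_mult_distrib)
  qed
  have eq: "(\<lambda>k. ?f k \<tau>) sums (a ^ jump_count \<tau> t)" if "\<tau> \<in> space holding_times" for \<tau>
    using sums_finite[of "{jump_count \<tau> t}" "\<lambda>k. ?f k \<tau>"] that by auto
  have "(\<lambda>k. integral\<^sup>L holding_times (?f k)) sums (\<integral>\<tau>. (\<Sum>k. ?f k \<tau>) \<partial>holding_times)"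
  proof (rule sums_integral)
    show "AE \<tau> in holding_times. summable (\<lambda>k. norm (?f k \<tau>))"
    proof (rule AE_I2)
      fix \<tau>
      show "summable (\<lambda>k. norm (?f k \<tau>))"
        by (rule summable_finite[of "{jump_count \<tau> t}"]) (auto simp: indicator_def)
    qed
    have "(\<integral>\<tau>. norm (?f k \<tau>) \<partial>holding_times) = \<bar>a\<bar> ^ k * prob (?A k)" for k
      by (simp add: abs_mult power_abs)
    then show "summable (\<lambda>k. \<integral>\<tau>. norm (?f k \<tau>) \<partial>holding_times)"
      using s[of "\<bar>a\<bar>"] by (simp add: sums_iff)
    show "integrable holding_times (?f k)" for k
      by (intro integrable_mult_right integrable_real_indicator) (auto simp: emeasure_eq_measure)
  qed
  also have "(\<integral>\<tau>. (\<Sum>k. ?f k \<tau>) \<partial>holding_times) = (\<integral>\<tau>. a ^ jump_count \<tau> t \<partial>holding_times)"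
    using eq by (intro Bochner_Integration.integral_cong refl) (auto simp: sums_iff)
  finally show ?thesis using s[of a] by (simp add: sums_iff)
qed

section \<open>Spectral representation of the semigroup\<close>

text \<open>The recursion appends steps at the end; moving a prefixed step into the starting point
  makes it fit for first-step analysis.\<close>

lemma skeleton_case_nat:
  "skeleton N x (case_nat s \<eta>) (Suc n) = skeleton N (x \<otimes>\<^bsub>hgroup N\<^esub> s) \<eta> n"
  by (induction n) auto

context hwalk
begin

interpretation G: group "hgroup N" by (rule group_hgroup)

abbreviation steps :: "(nat \<Rightarrow> nat \<Rightarrow> int) measure" where
  "steps \<equiv> \<Pi>\<^sub>M i\<in>UNIV. measure_pmf (step_pmf N r)"

abbreviation W :: "((nat \<Rightarrow> real) \<times> (nat \<Rightarrow> nat \<Rightarrow> int)) measure" where "W \<equiv> walk_space N r"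

sublocale steps: sequence_space "measure_pmf (step_pmf N r)"
  by unfold_locales

sublocale W: prob_space W by (rule prob_space_walk_space)

text \<open>Allows expectation and the sum over target points to be exchanged in
  \<open>semigroup_op_eq\<close>, although the type of positions is uncountable.\<close>

lemma countable_C: "countable C"
proof -
  have "countable {x \<in> C. hnorm x \<le> k}" for k
    by (rule countable_finite[OF card_hball(2)[OF N]])
  then have "countable (\<Union>k. {x \<in> C. hnorm x \<le> k})" by simp
  also have "(\<Union>k. {x \<in> C. hnorm x \<le> k}) = C" by auto
  finally show ?thesis .
qed

lemma skeleton_in_C:
  assumes "x \<in> C" "\<And>n. \<eta> n \<in> C"
  shows "skeleton N x \<eta> n \<in> C"
  by (induction n) (use assms in auto)

lemma AE_steps_in_C: "AE \<eta> in steps. \<forall>n. \<eta> n \<in> C"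
proof -
  have "AE y in measure_pmf (step_pmf N r). y \<in> C"
    using set_step_pmf by (auto simp: AE_measure_pmf_iff)
  then have "AE \<eta> in steps. \<eta> n \<in> C" for n
    by (intro AE_PiM_component prob_space_measure_pmf) auto
  then show ?thesis by (simp add: AE_all_countable)
qed

lemma measurable_add_mod:
  assumes [measurable]: "f \<in> M \<rightarrow>\<^sub>M count_space UNIV" "g \<in> M \<rightarrow>\<^sub>M count_space UNIV"
  shows "(\<lambda>x. (f x + g x :: int) mod m) \<in> M \<rightarrow>\<^sub>M count_space UNIV"
  by measurable

lemma measurable_skeleton_steps [measurable]:
  "(\<lambda>\<eta>. skeleton N x \<eta> n i) \<in> steps \<rightarrow>\<^sub>M count_space UNIV"
proof (induction n)
  case (Suc n)
  have "(\<lambda>\<eta>. \<eta> n) \<in> steps \<rightarrow>\<^sub>M measure_pmf (step_pmf N r)" by measurable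
  moreover have "(\<lambda>y. y i) \<in> measure_pmf (step_pmf N r) \<rightarrow>\<^sub>M count_space UNIV" by simp
  ultimately have [measurable]: "(\<lambda>\<eta>. \<eta> n i) \<in> steps \<rightarrow>\<^sub>M count_space UNIV"
    by (rule measurable_compose)
  note Suc[measurable]
  show ?case
    by (cases "i \<ge> 1") (auto simp: hgroup_def intro!: measurable_add_mod Suc \<open>(\<lambda>\<eta>. \<eta> n i) \<in> _\<close>)
qed simp

lemma measurable_sph_skeleton [measurable]:
  "(\<lambda>\<eta>. \<phi> j (skeleton N x \<eta> n)) \<in> borel_measurable steps"
  unfolding sph_def by measurable

text \<open>Peeling off the first step rather than the last one needs no independence argument.\<close>

lemma skeleton_eigenfunction:
  assumes "x \<in> C"
  shows "(\<integral>\<eta>. \<phi> j (skeleton N x \<eta> n) \<partial>steps) = eigval j ^ n * \<phi> j x"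
  using assms
proof (induction n arbitrary: x)
  case 0
  show ?case
    using prob_space.prob_space[OF prob_space_PiM, of UNIV "\<lambda>_::nat. measure_pmf (step_pmf N r)"]
    by (simp add: prob_space_measure_pmf)
next
  case (Suc n)
  let ?M = "measure_pmf (step_pmf N r)"
  interpret P: pair_prob_space ?M steps ..
  have m: "(\<lambda>p. case_nat (fst p) (snd p)) \<in> ?M \<Otimes>\<^sub>M steps \<rightarrow>\<^sub>M steps"
    by measurable
  \<comment> \<open>Joint measurability comes from composing with the shifted sequence, since the
    group operation need not be measurable on a product of discrete sigma-algebras.\<close>
  have mf: "(\<lambda>p. \<phi> j (skeleton N (x \<otimes>\<^bsub>hgroup N\<^esub> fst p) (snd p) n)) \<in> borel_measurable (?M \<Otimes>\<^sub>M steps)"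
    using measurable_compose[OF m measurable_sph_skeleton[of j x "Suc n"]]
    by (simp only: skeleton_case_nat)
  have "(\<integral>\<eta>. \<phi> j (skeleton N x \<eta> (Suc n)) \<partial>steps) =
      (\<integral>\<eta>. \<phi> j (skeleton N x \<eta> (Suc n)) \<partial>distr (?M \<Otimes>\<^sub>M steps) steps (\<lambda>p. case_nat (fst p) (snd p)))"
    using steps.PiM_iter by (simp add: case_prod_beta' )
  also have "\<dots> = (\<integral>p. \<phi> j (skeleton N x (case_nat (fst p) (snd p)) (Suc n)) \<partial>(?M \<Otimes>\<^sub>M steps))"
    by (intro integral_distr m measurable_sph_skeleton)
  also have "\<dots> = (\<integral>p. \<phi> j (skeleton N (x \<otimes>\<^bsub>hgroup N\<^esub> fst p) (snd p) n) \<partial>(?M \<Otimes>\<^sub>M steps))"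
    by (simp only: skeleton_case_nat)
  also have "\<dots> = (\<integral>s. \<integral>\<eta>. \<phi> j (skeleton N (x \<otimes>\<^bsub>hgroup N\<^esub> s) \<eta> n) \<partial>steps \<partial>?M)"
    using mf abs_sph_le_1[OF N] P.integral_fst'[of "\<lambda>p. \<phi> j (skeleton N (x \<otimes>\<^bsub>hgroup N\<^esub> fst p) (snd p) n)"]
    by (simp add: P.P.integrable_const_bound[where B = 1])
  also have "\<dots> = (\<integral>s. eigval j ^ n * \<phi> j (x \<otimes>\<^bsub>hgroup N\<^esub> s) \<partial>?M)"
  proof (rule integral_cong_AE)
    show "AE s in ?M. (\<integral>\<eta>. \<phi> j (skeleton N (x \<otimes>\<^bsub>hgroup N\<^esub> s) \<eta> n) \<partial>steps) = eigval j ^ n * \<phi> j (x \<otimes>\<^bsub>hgroup N\<^esub> s)"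
      using set_step_pmf Suc.prems by (auto simp: AE_measure_pmf_iff intro!: Suc.IH)
  qed auto
  also have "\<dots> = eigval j ^ Suc n * \<phi> j x"
    by (simp add: step_eigenfunction[OF Suc.prems])
  finally show ?case .
qed

section \<open>The position at time t and expectations along the walk\<close>

definition pos :: "(nat \<Rightarrow> int) \<Rightarrow> real \<Rightarrow> (nat \<Rightarrow> real) \<times> (nat \<Rightarrow> nat \<Rightarrow> int) \<Rightarrow> nat \<Rightarrow> int" where
  "pos x t \<omega> = skeleton N x (snd \<omega>) (jump_count (fst \<omega>) t)"

lemma AE_pos_in_C:
  assumes "x \<in> C"
  shows "AE \<omega> in W. pos x t \<omega> \<in> C"
proof -
  interpret H: prob_space holding_times by (rule prob_space_holding_times)
  interpret S: prob_space steps by (intro prob_space_PiM prob_space_measure_pmf)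
  interpret P: pair_prob_space holding_times steps ..
  have "AE \<omega> in holding_times \<Otimes>\<^sub>M steps. \<forall>n. snd \<omega> n \<in> C"
  proof (rule P.AE_pair_measure)
    have [measurable]: "Measurable.pred (measure_pmf (step_pmf N r)) (\<lambda>y. y \<in> C)" by simp
    show "{\<omega> \<in> space (holding_times \<Otimes>\<^sub>M steps). \<forall>n. snd \<omega> n \<in> C} \<in> sets (holding_times \<Otimes>\<^sub>M steps)"
      by measurable
    show "AE \<tau> in holding_times. AE \<eta> in steps. \<forall>n. snd (\<tau>, \<eta>) n \<in> C"
      using AE_steps_in_C by simp
  qed
  then show ?thesis
    unfolding walk_space_def
    by eventually_elim (auto simp: pos_def intro: skeleton_in_C assms)
qed

lemma measurable_pos: "(\<lambda>\<omega>. pos x t \<omega> i) \<in> W \<rightarrow>\<^sub>M count_space UNIV"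
proof -
  have [measurable]: "(\<lambda>\<omega>. jump_count (fst \<omega>) t) \<in> W \<rightarrow>\<^sub>M count_space UNIV"
    unfolding jump_count_def walk_space_def by measurable
  show ?thesis
    unfolding pos_def by (rule measurable_compose_countable[OF measurable_skeleton_coord]) measurable
qed

lemma measurable_sph_pos [measurable]: "(\<lambda>\<omega>. \<phi> j (pos x t \<omega>)) \<in> borel_measurable W"
proof -
  have [measurable]: "Measurable.pred W (\<lambda>\<omega>. pos x t \<omega> i = 0)" for i
    by (rule measurable_compose[OF measurable_pos]) simp
  show ?thesis unfolding sph_def by measurable
qed

lemma integrable_sph_pos: "integrable W (\<lambda>\<omega>. \<phi> j (pos x t \<omega>))"
  using abs_sph_le_1[OF N] by (intro W.integrable_const_bound[where B = 1]) auto

text \<open>For fixed holding times the steps contribute \<open>eigval j\<close> to the power of the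
  jump count; the Poisson generating function turns this into
  \<open>exp ((eigval j - 1) * t)\<close>.\<close>

lemma pos_eigenfunction:
  assumes x: "x \<in> C" and t: "t \<ge> 0"
  shows "(\<integral>\<omega>. \<phi> j (pos x t \<omega>) \<partial>W) = exp (- decay j * t) * \<phi> j x"
proof -
  interpret H: prob_space holding_times by (rule prob_space_holding_times)
  interpret P: pair_prob_space holding_times steps ..
  have "(\<integral>\<omega>. \<phi> j (pos x t \<omega>) \<partial>W) =
      (\<integral>\<tau>. \<integral>\<eta>. \<phi> j (skeleton N x \<eta> (jump_count \<tau> t)) \<partial>steps \<partial>holding_times)"
    using P.integral_fst'[of "\<lambda>\<omega>. \<phi> j (pos x t \<omega>)"] integrable_sph_pos[of j x t]
    by (simp add: walk_space_def pos_def)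
  also have "\<dots> = (\<integral>\<tau>. eigval j ^ jump_count \<tau> t \<partial>holding_times) * \<phi> j x"
    by (simp add: skeleton_eigenfunction[OF x])
  also have "\<dots> = exp (- decay j * t) * \<phi> j x"
    by (simp add: integral_power_jump_count[OF t] decay_def)
  finally show ?thesis .
qed

lemma semigroup_op_eq:
  assumes x: "x \<in> C"
  shows "semigroup_op N r t f x = (\<integral>\<^sup>+\<omega>. f (pos x t \<omega>) \<partial>W)"
proof -
  let ?E = "\<lambda>y. {\<omega> \<in> space W. pos x t \<omega> = y}"
  have E: "?E y \<in> sets W" for y using sets_walk_event[of N r x t y] by (simp add: pos_def)
  \<comment> \<open>Almost surely the position lies in \<open>C\<close>, so \<open>f\<close> along
    the walk is a countable sum over point events. Each summand is measurable for arbitrary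
    \<open>f\<close>, and Tonelli applies.\<close>
  have "(\<integral>\<^sup>+\<omega>. f (pos x t \<omega>) \<partial>W) = (\<integral>\<^sup>+\<omega>. \<integral>\<^sup>+y. f y * indicator (?E y) \<omega> \<partial>count_space C \<partial>W)"
  proof (rule nn_integral_cong_AE)
    show "AE \<omega> in W. f (pos x t \<omega>) = (\<integral>\<^sup>+y. f y * indicator (?E y) \<omega> \<partial>count_space C)"
      using AE_pos_in_C[OF x, of t] AE_space
    proof eventually_elim
      case (elim \<omega>)
      have "(\<integral>\<^sup>+y. f y * indicator (?E y) \<omega> \<partial>count_space C) =
          (\<integral>\<^sup>+y. f y * indicator {pos x t \<omega>} y \<partial>count_space C)"
        using elim by (intro nn_integral_cong) (auto simp: indicator_def)
      also have "\<dots> = f (pos x t \<omega>)"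
        using elim by (simp add: nn_integral_indicator_singleton)
      finally show ?case by simp
    qed
  qed
  also have "\<dots> = (\<integral>\<^sup>+y. \<integral>\<^sup>+\<omega>. f y * indicator (?E y) \<omega> \<partial>W \<partial>count_space C)"
    by (rule nn_integral_count_space_nn_integral[OF countable_C]) (use E in measurable)
  also have "\<dots> = semigroup_op N r t f x"
    unfolding semigroup_op_def trans_prob_def
    by (intro nn_integral_cong)
       (use E in \<open>auto simp: nn_integral_cmult_indicator W.emeasure_eq_measure pos_def mult.commute\<close>)
  finally show ?thesis by simp
qed

section \<open>Radial functions and the action of operators on their coefficients\<close>

definition radial :: "(nat \<Rightarrow> real) \<Rightarrow> (nat \<Rightarrow> int) \<Rightarrow> real" where
  "radial b x = (\<Sum>j. b j * \<phi> j x)"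

text \<open>The operators act on \<open>ennreal\<close>-valued functions while the spectral coefficients live in the
  reals and \<open>\<phi> j\<close> changes sign; hence the nonnegativity condition on the whole series.\<close>

definition represents :: "((nat \<Rightarrow> int) \<Rightarrow> ennreal) \<Rightarrow> (nat \<Rightarrow> real) \<Rightarrow> bool" where
  "represents f b \<longleftrightarrow> summable (\<lambda>j. \<bar>b j\<bar>) \<and> (\<forall>x\<in>C. radial b x \<ge> 0 \<and> f x = ennreal (radial b x))"

lemma abs_radial_term_le: "\<bar>b j * \<phi> j x\<bar> \<le> \<bar>b j\<bar>"
  using mult_left_mono[OF abs_sph_le_1[OF N, of j x], of "\<bar>b j\<bar>"] by (simp add: abs_mult)

lemma summable_radial:
  assumes "summable (\<lambda>j. \<bar>b j\<bar>)"
  shows "summable (\<lambda>j. \<bar>b j * \<phi> j x\<bar>)"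
  using abs_radial_term_le by (intro summable_comparison_test'[OF assms, of 0]) (simp only: real_norm_def abs_abs)

text \<open>The expectation is taken termwise, dominated by the absolute values of \<open>b\<close>.
  Nonnegativity of the new series is not visible from its coefficients; it holds because the series
  is the expectation of a nonnegative quantity.\<close>

lemma represents_semigroup_op:
  assumes f: "represents f b" and t: "t \<ge> 0"
  shows "represents (semigroup_op N r t f) (\<lambda>j. b j * exp (- decay j * t))"
  unfolding represents_def
proof (intro conjI ballI)
  have b: "summable (\<lambda>j. \<bar>b j\<bar>)" using f by (simp add: represents_def)
  show "summable (\<lambda>j. \<bar>b j * exp (- decay j * t)\<bar>)"
  proof (rule summable_comparison_test'[OF b])
    show "norm \<bar>b j * exp (- decay j * t)\<bar> \<le> \<bar>b j\<bar>" for j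
      using decay_pos[of j] t by (simp add: abs_mult mult_left_le)
  qed
  fix x assume x: "x \<in> C"
  let ?g = "\<lambda>j \<omega>. b j * \<phi> j (pos x t \<omega>)"
  have 1: "integrable W (?g j)" for j by (intro integrable_mult_right integrable_sph_pos)
  have 2: "AE \<omega> in W. summable (\<lambda>j. norm (?g j \<omega>))" using summable_radial[OF b] by simp
  have 3: "summable (\<lambda>j. \<integral>\<omega>. norm (?g j \<omega>) \<partial>W)"
  proof (rule summable_comparison_test'[OF b])
    fix j
    have "(\<integral>\<omega>. norm (?g j \<omega>) \<partial>W) \<le> (\<integral>\<omega>. \<bar>b j\<bar> \<partial>W)"
      using 1 abs_radial_term_le by (intro integral_mono integrable_norm) auto
    then show "norm (\<integral>\<omega>. norm (?g j \<omega>) \<partial>W) \<le> \<bar>b j\<bar>" by (simp add: W.prob_space)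
  qed
  have int: "integrable W (\<lambda>\<omega>. radial b (pos x t \<omega>))"
    unfolding radial_def by (rule integrable_suminf[OF 1 2 3])
  have "(\<integral>\<omega>. radial b (pos x t \<omega>) \<partial>W) = (\<Sum>j. \<integral>\<omega>. ?g j \<omega> \<partial>W)"
    unfolding radial_def by (rule integral_suminf[OF 1 2 3])
  also have "\<dots> = radial (\<lambda>j. b j * exp (- decay j * t)) x"
    by (simp add: radial_def pos_eigenfunction[OF x t] mult_ac)
  finally have eq: "(\<integral>\<omega>. radial b (pos x t \<omega>) \<partial>W) = radial (\<lambda>j. b j * exp (- decay j * t)) x" .
  have nn: "AE \<omega> in W. radial b (pos x t \<omega>) \<ge> 0"
    using AE_pos_in_C[OF x, of t] by eventually_elim (use f in \<open>auto simp: represents_def\<close>)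
  then show "radial (\<lambda>j. b j * exp (- decay j * t)) x \<ge> 0"
    unfolding eq[symmetric] by (rule integral_nonneg_AE)
  have "semigroup_op N r t f x = (\<integral>\<^sup>+\<omega>. ennreal (radial b (pos x t \<omega>)) \<partial>W)"
    unfolding semigroup_op_eq[OF x]
    using AE_pos_in_C[OF x, of t] f
    by (intro nn_integral_cong_AE) (auto simp: represents_def elim!: eventually_mono)
  also have "\<dots> = ennreal (radial (\<lambda>j. b j * exp (- decay j * t)) x)"
    using nn_integral_eq_integral[OF int nn] eq by simp
  finally show "semigroup_op N r t f x = ennreal (radial (\<lambda>j. b j * exp (- decay j * t)) x)" .
qed

text \<open>Serves \<open>green_upto\<close> and \<open>green\<close> alike: \<open>w\<close> is the
  Laplace transform of the indicator of \<open>A\<close> at the decay rates. For unbounded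
  \<open>A\<close> these values need not be bounded in \<open>j\<close>, hence the assumption
  \<open>bw\<close>.\<close>

lemma represents_time_integral:
  assumes f: "represents f b" and A: "A \<in> sets borel" "A \<subseteq> {0..}"
    and w: "\<And>j. has_bochner_integral lborel (\<lambda>s. indicator A s * exp (- decay j * s)) (w j)"
    and bw: "summable (\<lambda>j. \<bar>b j\<bar> * w j)"
  shows "represents (\<lambda>x. \<integral>\<^sup>+s\<in>A. semigroup_op N r s f x \<partial>lborel) (\<lambda>j. b j * w j)"
  unfolding represents_def
proof (intro conjI ballI)
  have b: "summable (\<lambda>j. \<bar>b j\<bar>)" using f by (simp add: represents_def)
  have w_nonneg: "w j \<ge> 0" for j
  proof -
    have "w j = (\<integral>s. indicator A s * exp (- decay j * s) \<partial>lborel)"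
      using w[of j] by (simp add: has_bochner_integral_iff)
    also have "\<dots> \<ge> 0" by (intro integral_nonneg_AE) simp
    finally show ?thesis .
  qed
  then show "summable (\<lambda>j. \<bar>b j * w j\<bar>)" using bw by (simp add: abs_mult)
  fix x assume x: "x \<in> C"
  let ?e = "\<lambda>j s. indicator A s * exp (- decay j * s) :: real"
  let ?g = "\<lambda>j s. (b j * \<phi> j x) * ?e j s"
  have e: "integrable lborel (?e j)" "integral\<^sup>L lborel (?e j) = w j" for j
    using w[of j] by (auto simp: has_bochner_integral_iff)
  have e_le: "\<bar>?e j s\<bar> \<le> 1" for j s
    using A(2) decay_pos[of j] by (auto simp: indicator_def)
  have 1: "integrable lborel (?g j)" for j by (intro integrable_mult_right e)
  have g_int: "integral\<^sup>L lborel (?g j) = b j * \<phi> j x * w j" for j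
    by (simp only: integral_mult_right_zero e(2))
  have 2: "AE s in lborel. summable (\<lambda>j. norm (?g j s))"
  proof (rule AE_I2)
    fix s show "summable (\<lambda>j. norm (?g j s))"
    proof (rule summable_comparison_test'[OF b])
      show "norm (norm (?g j s)) \<le> \<bar>b j\<bar>" for j
        using mult_mono[OF abs_radial_term_le[of b j x] e_le[of s j]] by (simp add: abs_mult)
    qed
  qed
  have 3: "summable (\<lambda>j. \<integral>s. norm (?g j s) \<partial>lborel)"
  proof (rule summable_comparison_test'[OF bw])
    fix j
    have "(\<integral>s. norm (?g j s) \<partial>lborel) = \<bar>b j * \<phi> j x\<bar> * w j"
      by (simp add: abs_mult e(2)[symmetric] mult.assoc)
    then show "norm (\<integral>s. norm (?g j s) \<partial>lborel) \<le> \<bar>b j\<bar> * w j"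
      using w_nonneg[of j] abs_radial_term_le[of b j x] by (simp add: mult_right_mono)
  qed
  have eq: "(\<Sum>j. ?g j s) = indicator A s * radial (\<lambda>j. b j * exp (- decay j * s)) x" for s
    by (cases "s \<in> A") (auto simp: radial_def mult_ac)
  have int: "integrable lborel (\<lambda>s. indicator A s * radial (\<lambda>j. b j * exp (- decay j * s)) x)"
    unfolding eq[symmetric] by (rule integrable_suminf[OF 1 2 3])
  have "(\<integral>s. indicator A s * radial (\<lambda>j. b j * exp (- decay j * s)) x \<partial>lborel) = (\<Sum>j. integral\<^sup>L lborel (?g j))"
    unfolding eq[symmetric] by (rule integral_suminf[OF 1 2 3])
  also have "\<dots> = radial (\<lambda>j. b j * w j) x"
    unfolding radial_def g_int by (simp add: mult_ac)
  finally have val: "(\<integral>s. indicator A s * radial (\<lambda>j. b j * exp (- decay j * s)) x \<partial>lborel) = radial (\<lambda>j. b j * w j) x" .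
  have rep: "radial (\<lambda>j. b j * exp (- decay j * s)) x \<ge> 0"
    "semigroup_op N r s f x = ennreal (radial (\<lambda>j. b j * exp (- decay j * s)) x)" if "s \<in> A" for s
    using represents_semigroup_op[OF f, of s] that A(2) x by (auto simp: represents_def)
  then have nn: "AE s in lborel. indicator A s * radial (\<lambda>j. b j * exp (- decay j * s)) x \<ge> 0"
    by (auto simp: indicator_def)
  then show "radial (\<lambda>j. b j * w j) x \<ge> 0"
    unfolding val[symmetric] by (rule integral_nonneg_AE)
  have "(\<integral>\<^sup>+s\<in>A. semigroup_op N r s f x \<partial>lborel) =
      (\<integral>\<^sup>+s. ennreal (indicator A s * radial (\<lambda>j. b j * exp (- decay j * s)) x) \<partial>lborel)"
    by (intro nn_integral_cong) (auto simp: rep indicator_def)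
  also have "\<dots> = ennreal (radial (\<lambda>j. b j * w j) x)"
    using nn_integral_eq_integral[OF int nn] val by simp
  finally show "(\<integral>\<^sup>+s\<in>A. semigroup_op N r s f x \<partial>lborel) = ennreal (radial (\<lambda>j. b j * w j) x)" .
qed

lemma represents_green_upto:
  assumes f: "represents f b" and t: "t \<ge> 0"
  shows "represents (green_upto N r t f) (\<lambda>j. b j * ((1 - exp (- decay j * t)) / decay j))"
proof -
  have w: "has_bochner_integral lborel (\<lambda>s. indicator {0..t} s * exp (- decay j * s)) ((1 - exp (- decay j * t)) / decay j)" for j
  proof -
    have "has_bochner_integral lborel (\<lambda>s. exp (- decay j * s) * indicator {0..t} s)
        (- exp (- decay j * t) / decay j - (- exp (- decay j * 0) / decay j))"
      using decay_pos[of j] t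
      by (intro has_bochner_integral_FTC_Icc_real)
         (auto intro!: derivative_eq_intros continuous_intros)
    then show ?thesis by (simp add: diff_divide_distrib mult.commute)
  qed
  \<comment> \<open>A finite horizon bounds every factor by \<open>t\<close>, so summability is
    inherited from \<open>b\<close>.\<close>
  have "summable (\<lambda>j. \<bar>b j\<bar> * ((1 - exp (- decay j * t)) / decay j))"
  proof (rule summable_comparison_test')
    show "summable (\<lambda>j. \<bar>b j\<bar> * t)" using f by (auto simp: represents_def intro: summable_mult2)
    fix j
    have "1 - exp (- decay j * t) \<le> decay j * t"
      using exp_ge_add_one_self[of "- decay j * t"] by simp
    then have "(1 - exp (- decay j * t)) / decay j \<le> t"
      using decay_pos[of j] by (simp add: pos_divide_le_eq mult.commute)
    moreover have "(1 - exp (- decay j * t)) / decay j \<ge> 0"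
      using decay_pos[of j] t by simp
    ultimately show "norm (\<bar>b j\<bar> * ((1 - exp (- decay j * t)) / decay j)) \<le> \<bar>b j\<bar> * t"
      using mult_left_mono[of "(1 - exp (- decay j * t)) / decay j" t "\<bar>b j\<bar>"]
      by (simp only: real_norm_def abs_mult abs_abs abs_of_nonneg abs_ge_zero)
  qed
  then show ?thesis
    unfolding green_upto_def by (intro represents_time_integral[OF f _ _ w]) auto
qed

text \<open>The factors \<open>1 / decay j\<close> are unbounded since the decay rates tend to 0.
  For \<open>b = mass\<close> the summability assumption expresses transience.\<close>

lemma represents_green:
  assumes f: "represents f b" and b: "summable (\<lambda>j. \<bar>b j\<bar> / decay j)"
  shows "represents (green N r f) (\<lambda>j. b j / decay j)"
proof -
  have w: "has_bochner_integral lborel (\<lambda>s. indicator {0..} s * exp (- decay j * s)) (1 / decay j)" for j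
  proof (rule has_bochner_integral_nn_integral)
    have "(\<integral>\<^sup>+s. ennreal (exp (- decay j * s)) * indicator {0..} s \<partial>lborel) =
        ennreal (0 - (- exp (- decay j * 0) / decay j))"
    proof (rule nn_integral_FTC_atLeast)
      show "((\<lambda>s. - exp (- decay j * s) / decay j) \<longlongrightarrow> 0) at_top"
      proof -
        have "((\<lambda>s. - exp (- d * s) / d) \<longlongrightarrow> 0) at_top" if "d > 0" for d :: real
          using that by real_asymp
        then show ?thesis using decay_pos[of j] .
      qed
    qed (use decay_pos[of j] in \<open>auto intro!: derivative_eq_intros\<close>)
    moreover have "ennreal (indicator {0..} s * exp (- decay j * s)) = ennreal (exp (- decay j * s)) * indicator {0..} s" for s
      by (auto simp: indicator_def)
    ultimately show "(\<integral>\<^sup>+s. ennreal (indicator {0..} s * exp (- decay j * s)) \<partial>lborel) = ennreal (1 / decay j)"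
      by simp
  qed (use decay_pos[of j] in \<open>auto simp: less_imp_le\<close>)
  have "represents (\<lambda>x. \<integral>\<^sup>+s\<in>{0..}. semigroup_op N r s f x \<partial>lborel) (\<lambda>j. b j * (1 / decay j))"
    using b by (intro represents_time_integral[OF f _ _ w]) auto
  then show ?thesis unfolding green_def[abs_def] by simp
qed

text \<open>Equal to \<open>N^-j - N^-(j+1)\<close>: the normalised Haar measure of the characters
  that are trivial on the ball of radius \<open>j\<close> but not on the next one.\<close>

definition mass :: "nat \<Rightarrow> real" where "mass j = (real N - 1) / real N ^ Suc j"

lemma mass_pos: "mass j > 0" using N by (simp add: mass_def)

lemma summable_mass: "summable mass"
proof -
  have "summable (\<lambda>j. (real N - 1) / real N * (1 / real N) ^ j)"
    using N by (intro summable_mult summable_geometric) auto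
  then show ?thesis by (simp add: mass_def[abs_def] power_divide)
qed

text \<open>The coefficients \<open>mass j\<close> make the expansion of the point mass at \<open>0\<close> a telescoping series of
  uniform distributions on balls.\<close>

lemma represents_indicator_one: "represents (indicator {\<one>\<^bsub>hgroup N\<^esub>}) mass"
  unfolding represents_def
proof (intro conjI ballI)
  show "summable (\<lambda>j. \<bar>mass j\<bar>)" using summable_mass mass_pos by (simp add: abs_of_pos)
  fix x assume x: "x \<in> C"
  let ?B = "\<lambda>j. of_bool (\<forall>i>j. x i = 0) / real N ^ j :: real"
  have lim: "?B \<longlonglongrightarrow> 0"
  proof (rule tendsto_sandwich[OF _ _ tendsto_const])
    show "(\<lambda>j. (1 / real N) ^ j) \<longlonglongrightarrow> 0" using N by (intro LIMSEQ_power_zero) auto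
  qed (auto simp: power_divide divide_right_mono)
  have "(\<lambda>j. ?B j - ?B (Suc j)) sums (?B 0 - 0)" by (rule telescope_sums'[OF lim])
  moreover have "?B j - ?B (Suc j) = mass j * \<phi> j x" for j
    using N by (auto simp: mass_def sph_def field_simps of_bool_def)
  moreover have "?B 0 = indicator {\<one>\<^bsub>hgroup N\<^esub>} x"
    using hnorm_eq_0_iff[OF N x] hnorm_le_iff[OF N x, of 0] by (simp add: indicator_def)
  ultimately have *: "radial mass x = indicator {\<one>\<^bsub>hgroup N\<^esub>} x"
    by (simp add: radial_def sums_iff)
  show "radial mass x \<ge> 0" "indicator {\<one>\<^bsub>hgroup N\<^esub>} x = ennreal (radial mass x)"
    unfolding * by (auto simp: indicator_def)
qed

lemma radial_one: "radial b \<one>\<^bsub>hgroup N\<^esub> = (\<Sum>j. b j)"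
proof -
  have "\<phi> j \<one>\<^bsub>hgroup N\<^esub> = 1" for j using N by (auto simp: sph_def one_hgroup restrict_def)
  then show ?thesis by (simp add: radial_def)
qed

text \<open>A represented function is finite at the identity, so the default 0 for infinite values
  in \<open>at_zero\<close> does not interfere.\<close>

lemma at_zero_eq:
  assumes "represents (A (indicator {\<one>\<^bsub>hgroup N\<^esub>})) b"
  shows "at_zero N A = (\<Sum>j. b j)"
proof -
  have "radial b \<one>\<^bsub>hgroup N\<^esub> \<ge> 0"
    "A (indicator {\<one>\<^bsub>hgroup N\<^esub>}) \<one>\<^bsub>hgroup N\<^esub> = ennreal (radial b \<one>\<^bsub>hgroup N\<^esub>)"
    using assms G.one_closed by (auto simp: represents_def)
  then show ?thesis by (simp add: at_zero_def radial_one)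
qed

lemma trans_prob_one:
  assumes "t \<ge> 0"
  shows "trans_prob N r t \<one>\<^bsub>hgroup N\<^esub> \<one>\<^bsub>hgroup N\<^esub> = (\<Sum>j. mass j * exp (- decay j * t))"
proof -
  have "at_zero N (semigroup_op N r t) = (\<Sum>j. mass j * exp (- decay j * t))"
    by (rule at_zero_eq, rule represents_semigroup_op[OF represents_indicator_one assms])
  moreover have "semigroup_op N r t (indicator {\<one>\<^bsub>hgroup N\<^esub>}) \<one>\<^bsub>hgroup N\<^esub> =
      ennreal (trans_prob N r t \<one>\<^bsub>hgroup N\<^esub> \<one>\<^bsub>hgroup N\<^esub>)"
    unfolding semigroup_op_def by (simp add: nn_integral_indicator_singleton)
  ultimately show ?thesis by (simp add: at_zero_def trans_prob_def)
qed

end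

section \<open>The incomplete Gamma integral\<close>

text \<open>The regularised lower incomplete Gamma function.\<close>

definition gamma_cdf :: "real \<Rightarrow> real \<Rightarrow> real" where
  "gamma_cdf \<mu> u = (\<integral>s. indicat_real {0..u} s * (s powr (\<mu> - 1) * exp (- s)) \<partial>lborel) / Gamma \<mu>"

lemma has_bochner_integral_Gamma:
  assumes "\<mu> > 0"
  shows "has_bochner_integral lborel (\<lambda>s. indicat_real {0..} s * (s powr (\<mu> - 1) * exp (- s))) (Gamma \<mu>)"
proof (rule has_bochner_integral_nn_integral)
  have "((\<lambda>s. s powr (\<mu> - 1) * exp (- s)) has_integral Gamma \<mu>) {0..}"
    using Gamma_integral_real[OF assms] by (simp add: exp_minus divide_inverse)
  then show "(\<integral>\<^sup>+s. ennreal (indicat_real {0..} s * (s powr (\<mu> - 1) * exp (- s))) \<partial>lborel) = ennreal (Gamma \<mu>)"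
    by (intro nn_integral_has_integral_lebesgue) auto
qed (use assms in \<open>auto simp: less_imp_le Gamma_real_pos\<close>)

lemma has_bochner_integral_powr:
  assumes "\<mu> > 0" "u \<ge> 0"
  shows "has_bochner_integral lborel (\<lambda>s. indicat_real {0..u} s * s powr (\<mu> - 1)) (u powr \<mu> / \<mu>)"
proof (rule has_bochner_integral_nn_integral)
  have "((\<lambda>s. s powr (\<mu> - 1)) has_integral (u powr \<mu> / \<mu>)) {0..u}"
    using has_integral_powr_from_0[of "\<mu> - 1" u] assms by simp
  then show "(\<integral>\<^sup>+s. ennreal (indicat_real {0..u} s * s powr (\<mu> - 1)) \<partial>lborel) = ennreal (u powr \<mu> / \<mu>)"
    by (intro nn_integral_has_integral_lebesgue) auto
qed (use assms in auto)

text \<open>For \<open>\<mu> < 1\<close> the integrand is singular at 0; it is dominated by the pure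
  power, which is integrable there because \<open>\<mu> > 0\<close>.\<close>

lemma integrable_powr_exp:
  assumes "\<mu> > 0" "u \<ge> 0" "h \<ge> 0"
  shows "integrable lborel (\<lambda>s. indicat_real {0..u} s * (s powr (\<mu> - 1) * exp (- h * s)))"
proof (rule Bochner_Integration.integrable_bound)
  show "integrable lborel (\<lambda>s. indicat_real {0..u} s * s powr (\<mu> - 1))"
    using has_bochner_integral_powr[OF assms(1,2)] by (simp add: has_bochner_integral_iff)
  show "AE s in lborel. norm (indicat_real {0..u} s * (s powr (\<mu> - 1) * exp (- h * s))) \<le> norm (indicat_real {0..u} s * s powr (\<mu> - 1))"
    using assms(3) by (intro AE_I2) (auto simp: indicator_def mult_left_le)
qed measurable

lemma integral_powr_exp_le:
  assumes "\<mu> > 0" "u \<ge> 0" "h \<ge> 0"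
  shows "(\<integral>s. indicat_real {0..u} s * (s powr (\<mu> - 1) * exp (- h * s)) \<partial>lborel) \<le> u powr \<mu> / \<mu>"
proof -
  have "(\<integral>s. indicat_real {0..u} s * (s powr (\<mu> - 1) * exp (- h * s)) \<partial>lborel) \<le>
      (\<integral>s. indicat_real {0..u} s * s powr (\<mu> - 1) \<partial>lborel)"
    using has_bochner_integral_powr[OF assms(1,2)] assms(3)
    by (intro integral_mono integrable_powr_exp assms)
       (auto simp: has_bochner_integral_iff indicator_def mult_left_le)
  also have "\<dots> = u powr \<mu> / \<mu>"
    using has_bochner_integral_powr[OF assms(1,2)] by (simp add: has_bochner_integral_iff)
  finally show ?thesis .
qed

lemma gamma_cdf_nonneg: "\<mu> > 0 \<Longrightarrow> gamma_cdf \<mu> u \<ge> 0"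
  unfolding gamma_cdf_def by (intro divide_nonneg_pos integral_nonneg_AE Gamma_real_pos) auto

lemma gamma_cdf_le_1:
  assumes "\<mu> > 0" "u \<ge> 0"
  shows "gamma_cdf \<mu> u \<le> 1"
proof -
  have "(\<integral>s. indicat_real {0..u} s * (s powr (\<mu> - 1) * exp (- s)) \<partial>lborel) \<le>
      (\<integral>s. indicat_real {0..} s * (s powr (\<mu> - 1) * exp (- s)) \<partial>lborel)"
    using has_bochner_integral_Gamma[OF assms(1)] integrable_powr_exp[OF assms, of 1]
    by (intro integral_mono) (auto simp: has_bochner_integral_iff indicator_def)
  also have "\<dots> = Gamma \<mu>"
    using has_bochner_integral_Gamma[OF assms(1)] by (simp add: has_bochner_integral_iff)
  finally show ?thesis using Gamma_real_pos[OF assms(1)] by (simp add: gamma_cdf_def)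
qed

text \<open>Dropping the exponential gives the order of vanishing at 0; this feeds the cutoff
  argument with \<open>\<kappa> = \<mu>\<close>.\<close>

lemma gamma_cdf_le_powr:
  assumes "\<mu> > 0" "u \<ge> 0"
  shows "gamma_cdf \<mu> u \<le> 1 / (\<mu> * Gamma \<mu>) * u powr \<mu>"
  using integral_powr_exp_le[OF assms, of 1] Gamma_real_pos[OF assms(1)] assms(1)
  unfolding gamma_cdf_def by (simp add: field_simps)

lemma gamma_cdf_tendsto_1:
  assumes "\<mu> > 0"
  shows "(gamma_cdf \<mu> \<longlongrightarrow> 1) at_top"
proof -
  let ?f = "\<lambda>s. indicat_real {0..} s * (s powr (\<mu> - 1) * exp (- s)) :: real"
  have G: "integrable lborel ?f" "integral\<^sup>L lborel ?f = Gamma \<mu>"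
    using has_bochner_integral_Gamma[OF assms] by (auto simp: has_bochner_integral_iff)
  have "((\<lambda>u. \<integral>s. indicat_real {0..u} s * (s powr (\<mu> - 1) * exp (- s)) \<partial>lborel) \<longlongrightarrow> integral\<^sup>L lborel ?f) at_top"
  proof (rule integral_dominated_convergence_at_top[where w = ?f])
    show "AE s in lborel. ((\<lambda>u. indicat_real {0..u} s * (s powr (\<mu> - 1) * exp (- s))) \<longlongrightarrow> ?f s) at_top"
    proof (intro AE_I2 tendsto_eventually)
      fix s :: real
      show "\<forall>\<^sub>F u in at_top. indicat_real {0..u} s * (s powr (\<mu> - 1) * exp (- s)) = ?f s"
        using eventually_ge_at_top[of s] by eventually_elim (auto simp: indicator_def)
    qed
    show "integrable lborel ?f" by (rule G(1))
    show "\<forall>\<^sub>F u in at_top. AE s in lborel. norm (indicat_real {0..u} s * (s powr (\<mu> - 1) * exp (- s))) \<le> ?f s"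
      by (intro always_eventually allI AE_I2) (auto simp: indicator_def)
  qed auto
  then have "((\<lambda>u. (\<integral>s. indicat_real {0..u} s * (s powr (\<mu> - 1) * exp (- s)) \<partial>lborel) / Gamma \<mu>) \<longlongrightarrow> Gamma \<mu> / Gamma \<mu>) at_top"
    unfolding G(2) using Gamma_real_pos[OF assms] by (intro tendsto_divide tendsto_const) auto
  then show ?thesis using Gamma_real_pos[OF assms] by (simp add: gamma_cdf_def[abs_def])
qed

text \<open>Substituting \<open>h * s\<close> for \<open>s\<close> isolates
  \<open>h powr (- \<mu>)\<close> and leaves a function of \<open>h * t\<close> alone.\<close>

lemma integral_powr_exp_eq:
  assumes "\<mu> > 0" "h > 0"
  shows "(\<integral>s. indicat_real {0..t} s * (s powr (\<mu> - 1) * exp (- h * s)) \<partial>lborel) =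
    h powr (- \<mu>) * Gamma \<mu> * gamma_cdf \<mu> (h * t)"
proof -
  have "Gamma \<mu> * gamma_cdf \<mu> (h * t) = (\<integral>s. indicat_real {0..h * t} s * (s powr (\<mu> - 1) * exp (- s)) \<partial>lborel)"
    using Gamma_real_pos[OF assms(1)] by (simp add: gamma_cdf_def)
  also have "\<dots> = h * (\<integral>s. indicat_real {0..h * t} (h * s) * ((h * s) powr (\<mu> - 1) * exp (- (h * s))) \<partial>lborel)"
    using assms by (subst lborel_integral_real_affine[where c = h and t = 0]) auto
  also have "(\<lambda>s. indicat_real {0..h * t} (h * s) * ((h * s) powr (\<mu> - 1) * exp (- (h * s)))) =
      (\<lambda>s. h powr (\<mu> - 1) * (indicat_real {0..t} s * (s powr (\<mu> - 1) * exp (- h * s))))"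
  proof
    fix s
    have "h * s \<in> {0..h * t} \<longleftrightarrow> s \<in> {0..t}" using assms by (simp add: zero_le_mult_iff)
    then show "indicat_real {0..h * t} (h * s) * ((h * s) powr (\<mu> - 1) * exp (- (h * s))) =
      h powr (\<mu> - 1) * (indicat_real {0..t} s * (s powr (\<mu> - 1) * exp (- h * s)))"
      using assms by (cases "s \<in> {0..t}") (auto simp: powr_mult)
  qed
  also have "h * (\<integral>s. h powr (\<mu> - 1) * (indicat_real {0..t} s * (s powr (\<mu> - 1) * exp (- h * s))) \<partial>lborel) =
      h powr \<mu> * (\<integral>s. indicat_real {0..t} s * (s powr (\<mu> - 1) * exp (- h * s)) \<partial>lborel)"
    proof -
    have "h * h powr (\<mu> - 1) = h powr \<mu>" using assms by (simp add: powr_diff)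
    then show ?thesis unfolding integral_mult_right_zero by (simp only: mult.assoc[symmetric])
  qed
  finally show ?thesis using assms by (simp add: powr_minus field_simps)
qed

section \<open>Fractional and iterated Green operators\<close>

context hwalk
begin

text \<open>Termwise integration of the spectral series of the return probability. Its terms are
  nonnegative, and without the exponential the \<open>j\<close>-th integral is at most
  \<open>mass j * (t powr \<mu> / \<mu>)\<close>, which is summable.\<close>

lemma frac_green_eq:
  assumes \<mu>: "\<mu> > 0" and t: "t \<ge> 0"
  shows "frac_green N r \<mu> t = (\<Sum>j. mass j * decay j powr (- \<mu>) * gamma_cdf \<mu> (decay j * t))"
proof -
  let ?e = "\<lambda>j s. indicat_real {0..t} s * (s powr (\<mu> - 1) * exp (- decay j * s)) :: real"
  let ?g = "\<lambda>j s. mass j * ?e j s"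
  have dn: "decay j \<ge> 0" for j using decay_pos[of j] by simp
  have 1: "integrable lborel (?g j)" for j
    by (intro integrable_mult_right integrable_powr_exp \<mu> t dn)
  have norm: "norm (?g j s) = ?g j s" for j s
    using mass_pos[of j] by simp
  have 2: "AE s in lborel. summable (\<lambda>j. norm (?g j s))"
  proof (rule AE_I2)
    fix s
    show "summable (\<lambda>j. norm (?g j s))"
    proof (rule summable_comparison_test')
      show "summable (\<lambda>j. mass j * s powr (\<mu> - 1))" by (intro summable_mult2 summable_mass)
      show "norm (norm (?g j s)) \<le> mass j * s powr (\<mu> - 1)" for j
        using mass_pos[of j] dn[of j] by (auto simp: indicator_def abs_mult mult_left_le)
    qed
  qed
  have 3: "summable (\<lambda>j. \<integral>s. norm (?g j s) \<partial>lborel)"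
  proof (rule summable_comparison_test')
    show "summable (\<lambda>j. mass j * (t powr \<mu> / \<mu>))" by (intro summable_mult2 summable_mass)
    fix j
    have "(\<integral>s. ?e j s \<partial>lborel) \<ge> 0" by (intro integral_nonneg_AE) auto
    then have "norm (\<integral>s. norm (?g j s) \<partial>lborel) = mass j * (\<integral>s. ?e j s \<partial>lborel)"
      unfolding norm integral_mult_right_zero using mass_pos[of j] by simp
    also have "\<dots> \<le> mass j * (t powr \<mu> / \<mu>)"
      using mass_pos[of j] by (intro mult_left_mono integral_powr_exp_le \<mu> t dn) simp
    finally show "norm (\<integral>s. norm (?g j s) \<partial>lborel) \<le> mass j * (t powr \<mu> / \<mu>)" .
  qed
  have "frac_green N r \<mu> t = 1 / Gamma \<mu> * (\<integral>s. (\<Sum>j. ?g j s) \<partial>lborel)"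
    unfolding frac_green_def set_lebesgue_integral_def
  proof (intro arg_cong2[where f = "(*)"] refl Bochner_Integration.integral_cong)
    fix s
    show "indicat_real {0..t} s *\<^sub>R (s powr (\<mu> - 1) * trans_prob N r s \<one>\<^bsub>hgroup N\<^esub> \<one>\<^bsub>hgroup N\<^esub>) = (\<Sum>j. ?g j s)"
    proof (cases "s \<in> {0..t}")
      case True
      have "summable (\<lambda>j. mass j * exp (- decay j * s))"
        using represents_semigroup_op[OF represents_indicator_one, of s] True mass_pos
        by (simp add: represents_def abs_mult abs_of_pos)
      from suminf_mult[OF this, of "s powr (\<mu> - 1)"] True show ?thesis
        by (simp add: trans_prob_one mult_ac)
    qed simp
  qed
  also have "(\<integral>s. (\<Sum>j. ?g j s) \<partial>lborel) = (\<Sum>j. integral\<^sup>L lborel (?g j))"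
    by (rule integral_suminf[OF 1 2 3])
  also have "1 / Gamma \<mu> * \<dots> = (\<Sum>j. 1 / Gamma \<mu> * integral\<^sup>L lborel (?g j))"
    by (rule suminf_mult[OF summable_integral[OF 1 2 3], symmetric])
  also have "\<dots> = (\<Sum>j. mass j * decay j powr (- \<mu>) * gamma_cdf \<mu> (decay j * t))"
    unfolding integral_mult_right_zero integral_powr_exp_eq[OF \<mu> decay_pos]
    using Gamma_real_pos[OF \<mu>] by (intro suminf_cong) simp
  finally show ?thesis .
qed

lemma at_zero_green_upto:
  assumes "t \<ge> 0"
  shows "at_zero N (green_upto N r t) = (\<Sum>j. mass j * ((1 - exp (- decay j * t)) / decay j))"
  by (rule at_zero_eq, rule represents_green_upto[OF represents_indicator_one assms])

lemma at_zero_green_upto_square: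
  assumes "t \<ge> 0"
  shows "at_zero N (green_upto N r t \<circ> green_upto N r t) =
    (\<Sum>j. mass j * ((1 - exp (- decay j * t)) / decay j) * ((1 - exp (- decay j * t)) / decay j))"
  by (rule at_zero_eq, unfold comp_def,
      rule represents_green_upto[OF represents_green_upto[OF represents_indicator_one assms] assms])

lemma at_zero_green_upto_square_green:
  assumes "t \<ge> 0" "summable (\<lambda>j. mass j / decay j)"
  shows "at_zero N (green_upto N r t \<circ> green_upto N r t \<circ> green N r) =
    (\<Sum>j. mass j / decay j * ((1 - exp (- decay j * t)) / decay j) * ((1 - exp (- decay j * t)) / decay j))"
proof -
  have "represents (green N r (indicator {\<one>\<^bsub>hgroup N\<^esub>})) (\<lambda>j. mass j / decay j)"
    using assms(2) mass_pos by (intro represents_green represents_indicator_one) (simp add: abs_of_pos)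
  from represents_green_upto[OF represents_green_upto[OF this assms(1)] assms(1)] show ?thesis
    by (intro at_zero_eq) (simp add: comp_def)
qed

end

section \<open>Sums with a smooth cutoff\<close>

lemma filterlim_partial_sums_at_top:
  fixes a :: "nat \<Rightarrow> real"
  assumes "\<And>j. a j \<ge> 0" "\<not> summable a"
  shows "filterlim (\<lambda>n. \<Sum>j=0..n. a j) at_top sequentially"
proof -
  have "\<exists>n. (\<Sum>j=0..n. a j) \<ge> Z" for Z
  proof (rule ccontr)
    assume "\<nexists>n. (\<Sum>j=0..n. a j) \<ge> Z"
    then have b: "(\<Sum>j=0..n. a j) \<le> Z" for n by (meson linear)
    have "(\<Sum>j<n. a j) \<le> Z" for n
    proof -
      have "(\<Sum>j<n. a j) \<le> (\<Sum>j=0..n. a j)" using assms(1) by (intro sum_mono2) auto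
      then show ?thesis using b[of n] by linarith
    qed
    then have "summable a" by (intro summableI_nonneg_bounded[where x = Z] assms(1))
    then show False using assms(2) by simp
  qed
  then show ?thesis
    unfolding filterlim_at_top
  proof safe
    fix Z :: real
    obtain n where n: "(\<Sum>j=0..n. a j) \<ge> Z" using \<open>\<And>Z. \<exists>n. (\<Sum>j=0..n. a j) \<ge> Z\<close> by blast
    have "(\<Sum>j=0..m. a j) \<ge> Z" if "m \<ge> n" for m
    proof -
      have "(\<Sum>j=0..n. a j) \<le> (\<Sum>j=0..m. a j)" using assms(1) that by (intro sum_mono2) auto
      then show ?thesis using n by linarith
    qed
    then show "\<forall>\<^sub>F m in sequentially. (\<Sum>j=0..m. a j) \<ge> Z"
      unfolding eventually_sequentially by blast
  qed
qed

text \<open>Since \<open>N\<^bsup>cutoff/\<mu>\<^esup>\<close> is \<open>t\<close> up to a factor \<open>N\<^bsup>1/\<mu>\<^esup>\<close>, the argument of \<open>\<Psi>\<close> grows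
  geometrically in \<open>cutoff - j\<close> below the cutoff, where \<open>\<Psi>\<close> is close to \<open>1\<close>; above the cutoff
  \<open>\<kappa> \<le> \<mu>\<close> makes the terms decay geometrically whatever the growth of \<open>d\<close>. So the sum differs
  from the truncated one by a bounded amount and an arbitrarily small proportion.\<close>

locale weighted_cutoff =
  fixes N :: nat and \<mu> \<kappa> D C :: real and d :: "nat \<Rightarrow> real" and \<Psi> :: "real \<Rightarrow> real"
  assumes N: "N \<ge> 2" and \<kappa>: "0 < \<kappa>" "\<kappa> \<le> \<mu>" and D: "D > 0"
    and d0: "d 0 > 0" and d_mono: "\<And>i j. i \<le> j \<Longrightarrow> d i \<le> d j"
    and not_summable: "\<not> summable (\<lambda>j. 1 / d j powr \<mu>)"
    and \<Psi>_nonneg: "\<And>u. u > 0 \<Longrightarrow> \<Psi> u \<ge> 0"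
    and \<Psi>_le_1: "\<And>u. u > 0 \<Longrightarrow> \<Psi> u \<le> 1"
    and \<Psi>_le_powr: "\<And>u. u > 0 \<Longrightarrow> \<Psi> u \<le> C * u powr \<kappa>"
    and \<Psi>_tendsto: "(\<Psi> \<longlongrightarrow> 1) at_top"
begin

definition cutoff :: "real \<Rightarrow> nat" where "cutoff t = nat \<lfloor>\<mu> * ln t / ln (real N)\<rfloor>"

definition weight :: "nat \<Rightarrow> real" where "weight j = 1 / d j powr \<mu>"

definition arg :: "real \<Rightarrow> nat \<Rightarrow> real" where "arg t j = D * d j * (t * real N powr (- real j / \<mu>))"

lemma d_pos: "d j > 0" using d0 d_mono[of 0 j] by simp

lemma weight_pos: "weight j > 0" using d_pos[of j] by (simp add: weight_def)

lemma weight_le: "weight j \<le> weight 0"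
  unfolding weight_def using d0 d_mono[of 0 j] \<kappa> by (intro divide_left_mono powr_mono2) auto

lemma arg_pos: "t > 0 \<Longrightarrow> arg t j > 0" using D d_pos[of j] N by (simp add: arg_def)

lemma C_nonneg: "C \<ge> 0"
  using \<Psi>_nonneg[of 1] \<Psi>_le_powr[of 1] by simp

lemma scale_bounds:
  assumes "t \<ge> 1"
  shows "t * real N powr (- real j / \<mu>) \<ge> real N powr ((real (cutoff t) - real j) / \<mu>)"
    and "t * real N powr (- real j / \<mu>) \<le> real N powr ((real (cutoff t) + 1 - real j) / \<mu>)"
proof -
  let ?x = "\<mu> * ln t / ln (real N)"
  have \<mu>: "\<mu> > 0" using \<kappa> by simp
  \<comment> \<open>Because \<open>t \<ge> 1\<close> the floor is nonnegative, so \<open>nat\<close>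
    truncates nothing.\<close>
  have "?x \<ge> 0" using assms \<mu> N by simp
  then have c: "real (cutoff t) \<le> ?x" "?x \<le> real (cutoff t) + 1"
    unfolding cutoff_def by linarith+
  have t: "t = real N powr (?x / \<mu>)" using assms N \<mu> by (simp add: powr_def)
  have eq: "t * real N powr (- real j / \<mu>) = real N powr ((?x - real j) / \<mu>)"
    by (subst t) (simp add: powr_add[symmetric] diff_divide_distrib)
  show "t * real N powr (- real j / \<mu>) \<ge> real N powr ((real (cutoff t) - real j) / \<mu>)"
    unfolding eq using N \<mu> c by (intro powr_mono divide_right_mono) auto
  show "t * real N powr (- real j / \<mu>) \<le> real N powr ((real (cutoff t) + 1 - real j) / \<mu>)"
    unfolding eq using N \<mu> c by (intro powr_mono divide_right_mono) auto
qed

text \<open>Together with \<open>B\<close>, the ratio and constant of the geometric bound beyond the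
  cutoff.\<close>

definition q :: real where "q = real N powr (- \<kappa> / \<mu>)"
definition B :: real where "B = C * D powr \<kappa> * d 0 powr (\<kappa> - \<mu>)"

lemma q_bounds: "0 < q" "q < 1"
  using N \<kappa> by (auto simp: q_def powr_less_one)

text \<open>Starting at \<open>Suc (cutoff t)\<close> absorbs the rounding of the cutoff. The powers
  of \<open>d\<close> combine to the exponent \<open>\<kappa> - \<mu> \<le> 0\<close>, so
  monotonicity bounds them by their value at \<open>d 0\<close>.\<close>

lemma tail_term_le:
  assumes "t \<ge> 1"
  shows "weight (i + Suc (cutoff t)) * \<Psi> (arg t (i + Suc (cutoff t))) \<le> B * q ^ i"
proof -
  let ?j = "i + Suc (cutoff t)"
  let ?s = "t * real N powr (- real ?j / \<mu>)"
  have s: "?s > 0" using assms N by simp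
  have "?s \<le> real N powr (- real i / \<mu>)"
    using scale_bounds(2)[OF assms, of ?j] by (simp add: algebra_simps)
  then have "?s powr \<kappa> \<le> (real N powr (- real i / \<mu>)) powr \<kappa>"
    using s \<kappa> by (intro powr_mono2) auto
  also have "\<dots> = q ^ i"
    using N by (simp add: q_def powr_powr powr_realpow[symmetric] mult_ac)
  finally have s_le: "?s powr \<kappa> \<le> q ^ i" .
  have "weight ?j * \<Psi> (arg t ?j) \<le> weight ?j * (C * arg t ?j powr \<kappa>)"
    using \<Psi>_le_powr[OF arg_pos, of t ?j] assms weight_pos[of ?j] by (simp add: mult_left_mono)
  also have "arg t ?j powr \<kappa> = D powr \<kappa> * d ?j powr \<kappa> * ?s powr \<kappa>"
    unfolding arg_def using D d_pos[of ?j] s by (simp only: powr_mult)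
  also have "weight ?j * (C * (D powr \<kappa> * d ?j powr \<kappa> * ?s powr \<kappa>)) =
      C * D powr \<kappa> * d ?j powr (\<kappa> - \<mu>) * ?s powr \<kappa>"
    by (simp add: weight_def powr_diff)
  also have "\<dots> \<le> C * D powr \<kappa> * d 0 powr (\<kappa> - \<mu>) * q ^ i"
  proof (rule mult_mono[OF _ s_le])
    have "d ?j powr (\<kappa> - \<mu>) \<le> d 0 powr (\<kappa> - \<mu>)"
      using d0 d_mono[of 0 ?j] \<kappa> by (intro powr_mono2') auto
    then show "C * D powr \<kappa> * d ?j powr (\<kappa> - \<mu>) \<le> C * D powr \<kappa> * d 0 powr (\<kappa> - \<mu>)"
      using C_nonneg by (intro mult_left_mono) auto
  qed (use C_nonneg in auto)
  finally show ?thesis by (simp add: B_def)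
qed

lemma term_nonneg: "t \<ge> 1 \<Longrightarrow> weight j * \<Psi> (arg t j) \<ge> 0"
  using weight_pos[of j] \<Psi>_nonneg[OF arg_pos, of t j] by simp

lemma summable_terms:
  assumes "t \<ge> 1"
  shows "summable (\<lambda>j. weight j * \<Psi> (arg t j))"
proof -
  have "summable (\<lambda>i. weight (i + Suc (cutoff t)) * \<Psi> (arg t (i + Suc (cutoff t))))"
  proof (rule summable_comparison_test')
    show "summable (\<lambda>i. B * q ^ i)" using q_bounds by (intro summable_mult summable_geometric) auto
    show "norm (weight (i + Suc (cutoff t)) * \<Psi> (arg t (i + Suc (cutoff t)))) \<le> B * q ^ i" for i
      using tail_term_le[OF assms, of i] term_nonneg[OF assms, of "i + Suc (cutoff t)"]
      by (simp only: real_norm_def abs_of_nonneg)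
  qed
  then show ?thesis by (subst (asm) summable_iff_shift)
qed

text \<open>Up to the cutoff \<open>\<Psi> \<le> 1\<close>; beyond it the geometric series gives a
  bound independent of \<open>t\<close>.\<close>

lemma upper:
  assumes "t \<ge> 1"
  shows "(\<Sum>j. weight j * \<Psi> (arg t j)) \<le> (\<Sum>j=0..cutoff t. weight j) + B / (1 - q)"
proof -
  let ?f = "\<lambda>j. weight j * \<Psi> (arg t j)"
  have "(\<Sum>j. ?f j) = (\<Sum>i. ?f (i + Suc (cutoff t))) + (\<Sum>j<Suc (cutoff t). ?f j)"
    using summable_terms[OF assms] by (rule suminf_split_initial_segment)
  also have "(\<Sum>i. ?f (i + Suc (cutoff t))) \<le> (\<Sum>i. B * q ^ i)"
    using tail_term_le[OF assms] summable_ignore_initial_segment[OF summable_terms[OF assms], of "Suc (cutoff t)"] q_bounds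
    by (intro suminf_le summable_mult summable_geometric) auto
  also have "(\<Sum>i. B * q ^ i) = B / (1 - q)"
    using q_bounds by (simp add: suminf_mult suminf_geometric)
  also have "(\<Sum>j<Suc (cutoff t). ?f j) \<le> (\<Sum>j<Suc (cutoff t). weight j)"
    using weight_pos \<Psi>_le_1[OF arg_pos, of t] assms
    by (intro sum_mono) (auto intro!: mult_left_le simp: less_imp_le)
  also have "(\<Sum>j<Suc (cutoff t). weight j) = (\<Sum>j=0..cutoff t. weight j)"
    by (simp only: lessThan_Suc_atMost atMost_atLeast0)
  finally show ?thesis by simp
qed

text \<open>Only the last \<open>M\<close> levels before the cutoff can have \<open>\<Psi>\<close>
  well below 1, and each of them costs at most \<open>weight 0\<close>. The number \<open>M\<close>
  depends on \<open>\<epsilon>\<close> but not on \<open>t\<close>.\<close>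

lemma lower:
  assumes "\<epsilon> > 0"
  obtains M :: nat where
    "\<And>t. t \<ge> 1 \<Longrightarrow> (\<Sum>j. weight j * \<Psi> (arg t j)) \<ge> (1 - \<epsilon>) * (\<Sum>j=0..cutoff t. weight j) - real M * weight 0"
proof (cases "\<epsilon> < 1")
  case False
  have "(\<Sum>j. weight j * \<Psi> (arg t j)) \<ge> (1 - \<epsilon>) * (\<Sum>j=0..cutoff t. weight j) - real 0 * weight 0"
    if "t \<ge> 1" for t
  proof -
    have "(1 - \<epsilon>) * (\<Sum>j=0..cutoff t. weight j) \<le> 0"
      using False weight_pos by (intro mult_nonpos_nonneg sum_nonneg) (auto simp: less_imp_le)
    also have "0 \<le> (\<Sum>j. weight j * \<Psi> (arg t j))"
      using summable_terms[OF that] term_nonneg[OF that] by (intro suminf_nonneg)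
    finally show ?thesis by simp
  qed
  then show ?thesis by (rule that)
next
  case True
  have \<mu>: "\<mu> > 0" using \<kappa> by simp
  have "\<forall>\<^sub>F u in at_top. \<Psi> u > 1 - \<epsilon>"
    using \<Psi>_tendsto assms by (intro order_tendstoD) auto
  then obtain u0 where u0: "\<And>u. u \<ge> u0 \<Longrightarrow> \<Psi> u > 1 - \<epsilon>"
    by (auto simp: eventually_at_top_linorder)
  have "filterlim (\<lambda>M. D * d 0 * real N powr (real M / \<mu>)) at_top sequentially"
    using D d0 N \<mu> by real_asymp
  then have "\<forall>\<^sub>F M in sequentially. D * d 0 * real N powr (real M / \<mu>) \<ge> u0"
    by (simp add: filterlim_at_top)
  \<comment> \<open>With \<open>d j \<ge> d 0\<close>, being \<open>M\<close> levels below the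
    cutoff forces the argument of \<open>\<Psi>\<close> above \<open>u0\<close>, uniformly in
    \<open>t\<close>.\<close>
  then obtain M where M: "D * d 0 * real N powr (real M / \<mu>) \<ge> u0"
    by (auto simp: eventually_sequentially)
  have "(\<Sum>j. weight j * \<Psi> (arg t j)) \<ge> (1 - \<epsilon>) * (\<Sum>j=0..cutoff t. weight j) - real M * weight 0"
    if t: "t \<ge> 1" for t
  proof -
    let ?J = "cutoff t"
    have main: "\<Psi> (arg t j) \<ge> 1 - \<epsilon>" if "j + M \<le> ?J" for j
    proof -
      have "u0 \<le> D * d 0 * real N powr (real M / \<mu>)" by (rule M)
      also have "\<dots> \<le> D * d j * real N powr ((real ?J - real j) / \<mu>)"
        using D d0 d_mono[of 0 j] N \<mu> that by (intro mult_mono powr_mono divide_right_mono) auto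
      also have "\<dots> \<le> arg t j"
        unfolding arg_def using scale_bounds(1)[OF t, of j] D d_pos[of j] by (intro mult_left_mono) auto
      finally show ?thesis using u0 by (simp add: less_imp_le)
    qed
    have "- (real M * weight 0) \<le> - (real (card {j. j \<le> ?J \<and> \<not> j + M \<le> ?J}) * weight 0)"
    proof -
      have "card {j. j \<le> ?J \<and> \<not> j + M \<le> ?J} \<le> card {?J + 1 - M ..< ?J + 1}"
        by (intro card_mono) auto
      then have "card {j. j \<le> ?J \<and> \<not> j + M \<le> ?J} \<le> M" by simp
      then show ?thesis using weight_pos[of 0] by simp
    qed
    \<comment> \<open>The loss is distributed over the levels: none where \<open>main\<close>
      applies, at most \<open>weight 0\<close> elsewhere.\<close>
    also have "\<dots> = (\<Sum>j\<in>{0..?J}. if j + M \<le> ?J then 0 else - weight 0)"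
      by (subst sum.If_cases) (auto simp: Int_def conj_commute)
    also have "\<dots> \<le> (\<Sum>j\<in>{0..?J}. weight j * (\<Psi> (arg t j) - (1 - \<epsilon>)))"
    proof (rule sum_mono)
      fix j
      have "weight j * (\<Psi> (arg t j) - (1 - \<epsilon>)) \<ge> - weight 0"
      proof -
        have "- (weight j * 1) \<le> weight j * (\<Psi> (arg t j) - (1 - \<epsilon>))"
          using weight_pos[of j] \<Psi>_nonneg[OF arg_pos, of t j] t assms True
          unfolding mult_minus_right[symmetric] by (intro mult_left_mono) auto
        then show ?thesis using weight_le[of j] by simp
      qed
      then show "(if j + M \<le> ?J then 0 else - weight 0) \<le> weight j * (\<Psi> (arg t j) - (1 - \<epsilon>))"
        using main[of j] weight_pos[of j] by auto
    qed
    also have "\<dots> = (\<Sum>j=0..?J. weight j * \<Psi> (arg t j)) - (1 - \<epsilon>) * (\<Sum>j=0..?J. weight j)"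
      by (simp add: algebra_simps sum.distrib sum_subtractf sum_distrib_left)
    also have "(\<Sum>j=0..?J. weight j * \<Psi> (arg t j)) \<le> (\<Sum>j. weight j * \<Psi> (arg t j))"
      using term_nonneg[OF t] by (intro sum_le_suminf summable_terms[OF t]) auto
    finally show ?thesis by simp
  qed
  then show ?thesis by (rule that)
qed

text \<open>The truncated sum tends to infinity and swallows the bounded errors in
  \<open>upper\<close> and \<open>lower\<close>.\<close>

theorem asymp_equiv_cutoff_sum:
  "(\<lambda>t. \<Sum>j. weight j * \<Psi> (arg t j)) \<sim>[at_top] (\<lambda>t. \<Sum>j=0..cutoff t. weight j)"
proof (rule asymp_equivI', rule order_tendstoI)
  let ?T = "\<lambda>t. \<Sum>j. weight j * \<Psi> (arg t j)" and ?S = "\<lambda>t. \<Sum>j=0..cutoff t. weight j"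
  have "filterlim (\<lambda>t. \<mu> / ln (real N) * ln t) at_top at_top"
    using \<kappa> N by (intro filterlim_tendsto_pos_mult_at_top[OF tendsto_const _ ln_at_top]) auto
  then have "filterlim (\<lambda>t. \<mu> * ln t / ln (real N)) at_top at_top" by simp
  then have "filterlim cutoff sequentially at_top"
    unfolding cutoff_def[abs_def]
    by (rule filterlim_compose[OF filterlim_nat_sequentially filterlim_compose[OF filterlim_floor_sequentially]])
  then have S: "filterlim ?S at_top at_top"
    using not_summable weight_pos
    by (intro filterlim_compose[OF filterlim_partial_sums_at_top, of weight cutoff])
       (auto simp: less_imp_le weight_def[abs_def])
  have t1: "\<forall>\<^sub>F t::real in at_top. t \<ge> 1" by (rule eventually_ge_at_top)
  {
    fix x :: real assume x: "x > 1"
    have "\<forall>\<^sub>F t in at_top. ?S t > max 0 (B / (1 - q) / (x - 1))"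
      using S unfolding filterlim_at_top_dense by blast
    then show "\<forall>\<^sub>F t in at_top. ?T t / ?S t < x" using t1
    proof eventually_elim
      case (elim t)
      then have S: "?S t > 0" and "?S t > B / (1 - q) / (x - 1)" by auto
      then have "B / (1 - q) < ?S t * (x - 1)" using x by (simp only: pos_divide_less_eq)
      moreover have "x * ?S t = ?S t + ?S t * (x - 1)" by (simp only: right_diff_distrib) simp
      ultimately have "?T t < x * ?S t" using upper[OF elim(2)] by linarith
      then show ?case using S by (simp only: pos_divide_less_eq)
    qed
  next
    fix x :: real assume x: "x < 1"
    \<comment> \<open>Half of the gap \<open>1 - x\<close> goes to the relative error; the other
      half times the truncated sum eventually exceeds the bounded loss.\<close>
    obtain M where M: "\<And>t. t \<ge> 1 \<Longrightarrow> ?T t \<ge> (1 - (1 - x) / 2) * ?S t - real M * weight 0"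
      using lower[of "(1 - x) / 2"] x by auto
    have "\<forall>\<^sub>F t in at_top. ?S t > max 0 (real M * weight 0 / ((1 - x) / 2))"
      using S unfolding filterlim_at_top_dense by blast
    then show "\<forall>\<^sub>F t in at_top. ?T t / ?S t > x" using t1
    proof eventually_elim
      case (elim t)
      then have S: "?S t > 0" and "?S t > real M * weight 0 / ((1 - x) / 2)" by auto
      then have "real M * weight 0 < ?S t * ((1 - x) / 2)" 
        using x by (subst (asm) pos_divide_less_eq) auto
      moreover have "x * ?S t = (1 - (1 - x) / 2) * ?S t - ?S t * ((1 - x) / 2)"
        by (simp add: field_simps)
      ultimately have "x * ?S t < ?T t" using M[OF elim(2)] by linarith
      then show ?case using S by (simp only: pos_less_divide_eq)
    qed
  }
qed

end

section \<open>Asymptotics\<close>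

locale mu_walk =
  fixes N :: nat and \<mu> :: real and c :: "nat \<Rightarrow> real"
  assumes N: "N \<ge> 2" and \<mu>: "\<mu> > 0" and c_pos: "\<And>j. c j > 0"
    and summable_c: "summable (\<lambda>j. c j * real N powr (- real j / \<mu>))"
    and d_Suc: "\<And>j. dseq \<mu> c N j \<le> dseq \<mu> c N (j + 1)"
    and not_summable: "\<not> summable (\<lambda>j. 1 / dseq \<mu> c N j powr \<mu>)"
begin

sublocale hwalk N "rate \<mu> c N"
  by unfold_locales (use N rate_pos_sums[of N c \<mu>] c_pos summable_c in auto)

abbreviation D :: real where "D \<equiv> norm_const \<mu> c N"
abbreviation d :: "nat \<Rightarrow> real" where "d \<equiv> dseq \<mu> c N"

section \<open>From the rates to the sequence d\<close>

lemma D_pos: "D > 0"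
  unfolding norm_const_def using suminf_pos[OF summable_c] c_pos N by simp

text \<open>Factoring \<open>D * N powr (- j / \<mu>)\<close> out of the tail of the rates leaves
  the sum in \<open>dseq\<close>, reindexed by \<open>i = k + Suc j\<close>. Nonnegative terms
  identify the unordered sum with the series.\<close>

lemma decay_eq: "decay j = D * d j * real N powr (- real j / \<mu>)"
proof -
  let ?f = "\<lambda>k. c (k + Suc j) / real N powr (real (Suc k) / \<mu>)"
  have f_eq: "D * real N powr (- real j / \<mu>) * ?f k = rate \<mu> c N (Suc (k + Suc j))" for k
  proof -
    have eq: "real N powr (- real j / \<mu>) / real N powr (real (Suc k) / \<mu>) = real N powr (- real (k + Suc j) / \<mu>)"
      unfolding powr_diff[symmetric] using \<mu> by (intro arg_cong[where f = "\<lambda>e. real N powr e"]) (simp add: field_simps)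
    show ?thesis unfolding rate_def diff_Suc_1 eq[symmetric] by simp
  qed
  have pos: "D * real N powr (- real j / \<mu>) > 0" using D_pos N by simp
  have "summable (\<lambda>k. rate \<mu> c N (Suc (k + Suc j)))"
    using sums_split_initial_segment[OF r_sums, of "Suc j"] by (simp add: sums_iff)
  then have "summable (\<lambda>k. D * real N powr (- real j / \<mu>) * ?f k)" by (simp only: f_eq)
  then have sum_f: "summable ?f" using pos by (simp only: summable_cmult_iff) auto
  have "(?f has_sum (\<Sum>k. ?f k)) UNIV"
    using sum_f c_pos by (intro sums_nonneg_imp_has_sum summable_sums) (auto simp: less_imp_le)
  moreover have "(?f has_sum (\<Sum>k. ?f k)) UNIV \<longleftrightarrow>
      ((\<lambda>i. c i / real N powr (real (i - j) / \<mu>)) has_sum (\<Sum>k. ?f k)) {j + 1..}"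
    by (rule has_sum_reindex_bij_witness[of _ "\<lambda>i. i - Suc j" "\<lambda>k. k + Suc j"]) (auto simp: Suc_diff_Suc)
  ultimately have inf: "(\<Sum>\<^sub>\<infinity>i\<in>{j + 1..}. c i / real N powr (real (i - j) / \<mu>)) = (\<Sum>k. ?f k)"
    using infsumI by blast
  have "decay j = real N / (real N - 1) * rate \<mu> c N (Suc j) + (\<Sum>k. D * real N powr (- real j / \<mu>) * ?f k)"
    unfolding decay_altdef f_eq by simp
  also have "\<dots> = D * d j * real N powr (- real j / \<mu>)"
    unfolding suminf_mult[OF sum_f] dseq_def inf by (simp add: rate_def algebra_simps)
  finally show ?thesis .
qed

lemma d_pos: "d j > 0"
  using decay_pos[of j] D_pos N by (simp add: decay_eq zero_less_mult_iff)

lemma d_mono: "i \<le> j \<Longrightarrow> d i \<le> d j"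
  by (rule lift_Suc_mono_le[of d]) (use d_Suc in auto)

definition K :: real where "K = (real N - 1) / (real N * D powr \<mu>)"

text \<open>The geometric factors cancel: \<open>mass j\<close> carries \<open>N^-j\<close>, while
  the power \<open>- \<mu>\<close> of the decay rate carries \<open>N^j\<close>. Only
  \<open>d\<close> remains to depend on the level.\<close>

lemma mass_decay: "mass j * decay j powr (- \<mu>) = K * (1 / d j powr \<mu>)"
proof -
  have "decay j powr \<mu> = D powr \<mu> * d j powr \<mu> * (real N powr (- real j / \<mu>)) powr \<mu>"
    unfolding decay_eq using D_pos d_pos[of j] N by (simp add: powr_mult)
  also have "(real N powr (- real j / \<mu>)) powr \<mu> = real N powr (- real j)"
    using \<mu> by (simp add: powr_powr)
  also have "\<dots> = 1 / real N ^ j"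
    using N by (simp add: powr_minus powr_realpow divide_inverse)
  finally have eq: "decay j powr \<mu> = D powr \<mu> * d j powr \<mu> * (1 / real N ^ j)" .
  show ?thesis
    unfolding powr_minus eq mass_def K_def using N D_pos d_pos[of j] by (simp add: field_simps)
qed

text \<open>Common reduction for all four asymptotics: each has only to supply its
  \<open>\<Psi>\<close>, an exponent \<open>\<kappa>\<close> and a constant.\<close>

lemma asymp_equiv_spectral_sum:
  assumes \<kappa>: "0 < \<kappa>" "\<kappa> \<le> \<mu>"
    and \<Psi>: "\<And>u. u > 0 \<Longrightarrow> \<Psi> u \<ge> 0" "\<And>u. u > 0 \<Longrightarrow> \<Psi> u \<le> 1" "\<And>u. u > 0 \<Longrightarrow> \<Psi> u \<le> B * u powr \<kappa>"
      "(\<Psi> \<longlongrightarrow> 1) at_top"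
    and f: "\<And>t. t \<ge> 0 \<Longrightarrow> f t = (\<Sum>j. mass j * decay j powr (- \<mu>) * \<Psi> (decay j * t))"
  shows "f \<sim>[at_top] (\<lambda>t. K * (\<Sum>j = 0..nat \<lfloor>\<mu> * ln t / ln (real N)\<rfloor>. 1 / d j powr \<mu>))"
proof -
  interpret weighted_cutoff N \<mu> \<kappa> D B d \<Psi>
    by unfold_locales (use N \<kappa> D_pos d_pos d_mono not_summable \<Psi> in auto)
  have "f t = K * (\<Sum>j. weight j * \<Psi> (arg t j))" if "t \<ge> 1" for t
  proof -
    have "f t = (\<Sum>j. K * (weight j * \<Psi> (arg t j)))"
      using that unfolding f[OF order.trans[OF zero_le_one that]] mass_decay
      by (simp add: weight_def arg_def decay_eq mult_ac)
    then show ?thesis using suminf_mult[OF summable_terms[OF that], of K] by simp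
  qed
  then have "f \<sim>[at_top] (\<lambda>t. K * (\<Sum>j. weight j * \<Psi> (arg t j)))"
    by (intro asymp_equiv_refl_ev eventually_mono[OF eventually_ge_at_top[of 1]]) auto
  also have "\<dots> \<sim>[at_top] (\<lambda>t. K * (\<Sum>j=0..cutoff t. weight j))"
    by (intro asymp_equiv_mult asymp_equiv_refl asymp_equiv_cutoff_sum)
  finally show ?thesis by (simp add: cutoff_def weight_def)
qed

section \<open>The individual Green quantities\<close>

lemma one_minus_exp_le: "u > 0 \<Longrightarrow> 1 - exp (- u) \<le> (u::real)"
  using exp_ge_add_one_self[of "- u"] by simp

lemma one_minus_exp_square_le: "u > 0 \<Longrightarrow> (1 - exp (- u))\<^sup>2 \<le> 1 * (u::real) powr 2"
  using power_mono[OF one_minus_exp_le, of u 2] by simp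

text \<open>Transience, required for \<open>green\<close>: since \<open>d\<close> is bounded below
  by \<open>d 0\<close>, the terms decay like \<open>N^-j * N powr (j / 3)\<close>.\<close>

lemma summable_mass_div_decay:
  assumes "\<mu> = 3"
  shows "summable (\<lambda>j. mass j / decay j)"
proof (rule summable_comparison_test')
  let ?q = "real N powr (- (2 / 3))"
  have "?q < 1" using N by (intro powr_less_one) auto
  then show "summable (\<lambda>j. (real N - 1) / (real N * D * d 0) * ?q ^ j)"
    by (intro summable_mult summable_geometric) auto
  fix j
  have "mass j / decay j = (real N - 1) / (real N * D * d j) * (real N powr (real j / 3) / real N ^ j)"
    unfolding mass_def decay_eq using N by (simp add: assms powr_minus field_simps)
  also have "real N powr (real j / 3) / real N ^ j = ?q ^ j"
    using N by (simp add: powr_realpow[symmetric] powr_powr powr_diff[symmetric])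
  also have "(real N - 1) / (real N * D * d j) * ?q ^ j \<le> (real N - 1) / (real N * D * d 0) * ?q ^ j"
    using N D_pos d_pos d_mono[of 0 j] by (intro mult_right_mono divide_left_mono mult_pos_pos mult_left_mono) auto
  finally show "norm (mass j / decay j) \<le> (real N - 1) / (real N * D * d 0) * ?q ^ j"
    using mass_pos[of j] decay_pos[of j] by simp
qed

lemma asymp_green_1:
  assumes "\<mu> = 1"
  shows "(\<lambda>t. at_zero N (green_upto N (rate \<mu> c N) t)) \<sim>[at_top]
    (\<lambda>t. K * (\<Sum>j = 0..nat \<lfloor>\<mu> * ln t / ln (real N)\<rfloor>. 1 / d j powr \<mu>))"
proof -
  have powr_\<mu>: "x powr (- \<mu>) = 1 / x" if "x > 0" for x :: real
    using that assms by (simp add: powr_minus powr_numeral divide_inverse)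
  show ?thesis
  proof (rule asymp_equiv_spectral_sum[of 1 "\<lambda>u. 1 - exp (- u)" 1])
  show "((\<lambda>u::real. 1 - exp (- u)) \<longlongrightarrow> 1) at_top" by real_asymp
  show "at_zero N (green_upto N (rate \<mu> c N) t) =
      (\<Sum>j. mass j * decay j powr (- \<mu>) * (1 - exp (- (decay j * t))))" if "t \<ge> 0" for t
    unfolding at_zero_green_upto[OF that] powr_\<mu>[OF decay_pos] by simp
qed (use assms one_minus_exp_le in auto)
qed

lemma asymp_green_2:
  assumes "\<mu> = 2"
  shows "(\<lambda>t. at_zero N (green_upto N (rate \<mu> c N) t \<circ> green_upto N (rate \<mu> c N) t)) \<sim>[at_top]
    (\<lambda>t. K * (\<Sum>j = 0..nat \<lfloor>\<mu> * ln t / ln (real N)\<rfloor>. 1 / d j powr \<mu>))"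
proof -
  have powr_\<mu>: "x powr (- \<mu>) = 1 / x\<^sup>2" if "x > 0" for x :: real
    using that assms by (simp add: powr_minus powr_numeral divide_inverse)
  show ?thesis
  proof (rule asymp_equiv_spectral_sum[of 2 "\<lambda>u. (1 - exp (- u))\<^sup>2" 1])
  show "((\<lambda>u::real. (1 - exp (- u))\<^sup>2) \<longlongrightarrow> 1) at_top" by real_asymp
  show "at_zero N (green_upto N (rate \<mu> c N) t \<circ> green_upto N (rate \<mu> c N) t) =
      (\<Sum>j. mass j * decay j powr (- \<mu>) * (1 - exp (- (decay j * t)))\<^sup>2)" if "t \<ge> 0" for t
    unfolding at_zero_green_upto_square[OF that] powr_\<mu>[OF decay_pos]
    by (simp add: power2_eq_square mult.assoc)
qed (use assms one_minus_exp_square_le in \<open>auto simp: power_le_one\<close>)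
qed

text \<open>The two truncated operators give the square of \<open>1 - exp (- u)\<close>, the full
  Green operator only a third factor \<open>1 / decay j\<close>. Hence \<open>\<kappa> = 2\<close>
  is strictly below \<open>\<mu> = 3\<close>.\<close>

lemma asymp_green_3:
  assumes "\<mu> = 3"
  shows "(\<lambda>t. at_zero N (green_upto N (rate \<mu> c N) t \<circ> green_upto N (rate \<mu> c N) t \<circ> green N (rate \<mu> c N))) \<sim>[at_top]
    (\<lambda>t. K * (\<Sum>j = 0..nat \<lfloor>\<mu> * ln t / ln (real N)\<rfloor>. 1 / d j powr \<mu>))"
proof -
  have powr_\<mu>: "x powr (- \<mu>) = 1 / x ^ 3" if "x > 0" for x :: real
    using that assms by (simp add: powr_minus powr_numeral divide_inverse)
  show ?thesis
  proof (rule asymp_equiv_spectral_sum[of 2 "\<lambda>u. (1 - exp (- u))\<^sup>2" 1])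
  show "((\<lambda>u::real. (1 - exp (- u))\<^sup>2) \<longlongrightarrow> 1) at_top" by real_asymp
  show "at_zero N (green_upto N (rate \<mu> c N) t \<circ> green_upto N (rate \<mu> c N) t \<circ> green N (rate \<mu> c N)) =
      (\<Sum>j. mass j * decay j powr (- \<mu>) * (1 - exp (- (decay j * t)))\<^sup>2)" if "t \<ge> 0" for t
    unfolding at_zero_green_upto_square_green[OF that summable_mass_div_decay[OF assms]]
      powr_\<mu>[OF decay_pos]
    by (simp add: power2_eq_square power3_eq_cube mult.assoc)
qed (use assms one_minus_exp_square_le in \<open>auto simp: power_le_one\<close>)
qed

lemma asymp_frac_green:
  "(\<lambda>t. frac_green N (rate \<mu> c N) \<mu> t) \<sim>[at_top]
    (\<lambda>t. K * (\<Sum>j = 0..nat \<lfloor>\<mu> * ln t / ln (real N)\<rfloor>. 1 / d j powr \<mu>))"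
  by (rule asymp_equiv_spectral_sum[of \<mu> "gamma_cdf \<mu>" "1 / (\<mu> * Gamma \<mu>)"])
     (use \<mu> gamma_cdf_nonneg gamma_cdf_le_1 gamma_cdf_le_powr gamma_cdf_tendsto_1 frac_green_eq in auto)

end

theorem proposition3p3p1:
  fixes N :: nat and \<mu> :: real and c :: "nat \<Rightarrow> real"
  assumes "N \<ge> 2"
    and "\<mu> > 0"
    and "\<And>j. c j > 0"
    and "summable (\<lambda>j. c j * real N powr (- real j / \<mu>))"
    and "\<And>j. dseq \<mu> c N j \<le> dseq \<mu> c N (j + 1)"
    and "\<not> summable (\<lambda>j. 1 / dseq \<mu> c N j powr \<mu>)"
  shows
    "let r = rate \<mu> c N;
         F = (\<lambda>t::real. (real N - 1) / (real N * norm_const \<mu> c N powr \<mu>) *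
               (\<Sum>j = 0..nat \<lfloor>\<mu> * ln t / ln (real N)\<rfloor>. 1 / dseq \<mu> c N j powr \<mu>))
     in (\<mu> = 1 \<longrightarrow> (\<lambda>t. at_zero N (green_upto N r t)) \<sim>[at_top] F) \<and>
        (\<mu> = 2 \<longrightarrow> (\<lambda>t. at_zero N (green_upto N r t \<circ> green_upto N r t)) \<sim>[at_top] F) \<and>
        (\<mu> = 3 \<longrightarrow>
          (\<lambda>t. at_zero N (green_upto N r t \<circ> green_upto N r t \<circ> green N r)) \<sim>[at_top] F) \<and>
        (\<lambda>t. frac_green N r \<mu> t) \<sim>[at_top] F"
proof -
  interpret mu_walk N \<mu> c using assms by unfold_locales auto
  show ?thesis
    unfolding Let_def K_def[symmetric]
    using asymp_green_1 asymp_green_2 asymp_green_3 asymp_frac_green by blast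
qed

end
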